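(* Let $N\in\{1,2\}$, $\lambda\ge 0$, let $L:\mathbb{R}\times\mathbb{R}\to\mathbb{R}$ be a $C^2$ function satisfying (L1)–(L6) listed in the context, and let $\mu$ be a Borel probability measure on $X_\lambda$ satisfying (M1)–(M3) listed in the context. Then for $\mu$-a.e. point of $X_\lambda$, its $\omega$-limit set with respect to the semiflow on $X_\lambda$ generated by $$\lambda\,\partial_{tt}u(\alpha)+\partial_t u(\alpha)=-\sum_{j=1}^N\Big(L_2(u(\alpha-\varepsilon_j),u(\alpha))+L_1(u(\alpha),u(\alpha+\varepsilon_j))\Big),\qquad \alpha\in\mathbb{Z}^N,$$ contains both equilibria $w_0$ and $w_1$.
   Context: Here $u:\mathbb{Z}^N\to\mathbb{R}$, $\varepsilon_1,\dots,\varepsilon_N$ is the standard basis of $\mathbb{Z}^N$, and $L_1,L_2,L_{12},L_{11},L_{22}$ denote partial derivatives of $L$ with respect to the first/second variables. Conditions on $L$ and $\lambda$: (L1) $L(x,y)=L(x+k,y+k)$ for all $k\in\mathbb{Z}$. (L2) $\lim_{|x-y|\to\infty}L(x,y)=+\infty$. (L3) The pair $(0,0)$ is the strict global minimum of $L$ (strict up to the translations in (L1)). (L4) $L_{12}\le 0$. (L5) $L(x,y)=L(-x,-y)$. (L6) $4\lambda B\le 1$, where $B=\max_{0\le x,y,z\le1}\big(L_{22}(x,y)+L_{11}(y,z)\big)$. State space. For $\lambda=0$: $X_0=\{u:\mathbb{Z}^N\to\mathbb{R}:\ 0\le u(\alpha)\le1\ \forall\alpha\}$. For $\lambda>0$: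 $X_\lambda$ is the set of pairs $(u,v)$ of functions $\mathbb{Z}^N\to\mathbb{R}$ with $0\le u(\alpha)\le1$ and $0\le2\lambda v(\alpha)+u(\alpha)\le1$ for all $\alpha$, where $v=\partial_tu$. $X_\lambda$ carries the product topology (pointwise convergence on $\mathbb{Z}^N$), in which it is compact; the equation generates a continuous semiflow on it. The $\omega$-limit set $\omega(\cdot)$ is the set of limit points of the semiorbit as $t\to\infty$ in this topology. Distinguished equilibria: for $\lambda=0$, $w_0\equiv0$, $w_1\equiv1$; for $\lambda>0$, $w_0\equiv(0,0)$, $w_1\equiv(1,0)$ (constant in $\alpha$). Translations $T^\beta$, $\beta\in\mathbb{Z}^N$: $(T^\beta w)(\alpha)=w(\alpha+\beta)$ for $w\in X_\lambda$. Reflection $R$: $(Ru)(\alpha)=1-u(\alpha)$ if $\lambda=0$; $(R(u,v))(\alpha)=(1-u(\alpha),-v(\alpha))$ if $\lambda>0$. $\mathcal{E}\subset X_\lambda$ is the set of equilibria (stationary points) of the semiflow. $\mathcal{S}\subset\mathcal{E}$ consists of $w_0$, $w_1$, and all $w\in\mathcal{E}$ for which there is $\varepsilon\in\{\pm\varepsilon_1,\dots,\pm\varepsilon_N\}$ such that $\lim_{n\to\infty}T^{n\varepsilon}w$ exists (in the product topology) and belongs to $\{w_0,w_1\}$. Conditions on the Borel probability measure $\mu$ on $X_\lambda$: (M1) $\mu$ is translationally invariant ($\mu(T^\beta(A))=\mu(A)$ for all $\beta\in\mathbb{Z}^N$ and measurable $A$) and ergodic (every measurable $A$ with $T^\beta(A)=A$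 for all $\beta\in\mathbb{Z}^N$ has $\mu(A)\in\{0,1\}$). (M2) $\mu$ is $R$-invariant. (M3) For $\mu$-a.e. $w\in X_\lambda$, $\omega(w)\cap(\mathcal{E}\setminus\mathcal{S})=\emptyset$.
   Formalization: For N=2, λ>0 and 8λB>1, (L1)–(L6) need not keep solutions in X_λ, so the semiflow may fail to exist; in that range it is additionally assumed that from every point of X_λ a solution staying in X_λ exists for all t≥0. *)

theory Defs
  imports "HOL-Probability.Probability"
begin

definition D1 :: "(real \<Rightarrow> real \<Rightarrow> real) \<Rightarrow> real \<Rightarrow> real \<Rightarrow> real" where
  "D1 f x y = deriv (\<lambda>s. f s y) x"

definition D2 :: "(real \<Rightarrow> real \<Rightarrow> real) \<Rightarrow> real \<Rightarrow> real \<Rightarrow> real" where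
  "D2 f x y = deriv (\<lambda>s. f x s) y"

definition C1 :: "(real \<Rightarrow> real \<Rightarrow> real) \<Rightarrow> bool" where
  "C1 f \<longleftrightarrow>
     (\<forall>x y. (\<lambda>s. f s y) differentiable (at x) \<and> (\<lambda>s. f x s) differentiable (at y)) \<and>
     continuous_on UNIV (\<lambda>(x, y). D1 f x y) \<and>
     continuous_on UNIV (\<lambda>(x, y). D2 f x y)"

definition C2 :: "(real \<Rightarrow> real \<Rightarrow> real) \<Rightarrow> bool" where
  "C2 f \<longleftrightarrow> C1 f \<and> C1 (D1 f) \<and> C1 (D2 f)"

text \<open>The supremum is attained when \<open>L\<close> is twice continuously differentiable, so it is the
  maximum of \<open>L\<^sub>2\<^sub>2(x, y) + L\<^sub>1\<^sub>1(y, z)\<close> over the unit cube.\<close>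

definition curvature_bound :: "(real \<Rightarrow> real \<Rightarrow> real) \<Rightarrow> real" where
  "curvature_bound L =
     (SUP (x, y, z)\<in>{0..1} \<times> {0..1} \<times> {0..1}. D2 (D2 L) x y + D1 (D1 L) y z)"

text \<open>The lattice \<open>\<int>\<^sup>N\<close> is the type \<open>int ^ 'n\<close> with \<open>N = CARD('n)\<close>, and
  \<open>axis j 1\<close> is its \<open>j\<close>-th standard basis vector. A state is a function on the lattice with
  values \<open>u(\<alpha>)\<close> in \<open>real\<close> if \<open>\<lambda> = 0\<close>, and with values \<open>(u(\<alpha>), v(\<alpha>))\<close> in
  \<open>real \<times> real\<close> if \<open>\<lambda> > 0\<close>. The library topology on function types is the product
  topology, so limits of states are pointwise limits.\<close>

definition overdamped_space :: "(int ^ 'n \<Rightarrow> real) set" where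
  "overdamped_space = {u. \<forall>\<alpha>. 0 \<le> u \<alpha> \<and> u \<alpha> \<le> 1}"

definition damped_space :: "real \<Rightarrow> (int ^ 'n \<Rightarrow> real \<times> real) set" where
  "damped_space lam =
     {w. \<forall>\<alpha>. 0 \<le> fst (w \<alpha>) \<and> fst (w \<alpha>) \<le> 1 \<and>
             0 \<le> 2 * lam * snd (w \<alpha>) + fst (w \<alpha>) \<and> 2 * lam * snd (w \<alpha>) + fst (w \<alpha>) \<le> 1}"

definition force ::
    "(real \<Rightarrow> real \<Rightarrow> real) \<Rightarrow> (int ^ 'n \<Rightarrow> real) \<Rightarrow> int ^ 'n \<Rightarrow> real" where
  "force L u \<alpha> =
     - (\<Sum>j\<in>UNIV. D2 L (u (\<alpha> - axis j 1)) (u \<alpha>) + D1 L (u \<alpha>) (u (\<alpha> + axis j 1)))"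

text \<open>Forward solutions that stay in the state space. Only the values at times \<open>t \<ge> 0\<close> matter.\<close>

definition overdamped_orbits ::
    "(real \<Rightarrow> real \<Rightarrow> real) \<Rightarrow> (real \<Rightarrow> int ^ 'n \<Rightarrow> real) set" where
  "overdamped_orbits L =
     {\<phi>. \<forall>t\<ge>0. \<phi> t \<in> overdamped_space \<and>
        (\<forall>\<alpha>. ((\<lambda>s. \<phi> s \<alpha>) has_real_derivative force L (\<phi> t) \<alpha>) (at t within {0..}))}"

text \<open>The second-order equation as a first-order system for \<open>(u, v)\<close>: \<open>u\<close> has derivative \<open>v\<close>,
  and \<open>\<lambda>\<close> times the derivative of \<open>v\<close>, plus \<open>v\<close>, is the force.\<close>

definition damped_orbits ::
    "real \<Rightarrow> (real \<Rightarrow> real \<Rightarrow> real) \<Rightarrow> (real \<Rightarrow> int ^ 'n \<Rightarrow> real \<times> real) set" where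
  "damped_orbits lam L =
     {\<phi>. \<forall>t\<ge>0. \<phi> t \<in> damped_space lam \<and>
        (\<forall>\<alpha>. ((\<lambda>s. fst (\<phi> s \<alpha>)) has_real_derivative snd (\<phi> t \<alpha>)) (at t within {0..}) \<and>
             ((\<lambda>s. snd (\<phi> s \<alpha>)) has_real_derivative
                (force L (\<lambda>\<beta>. fst (\<phi> t \<beta>)) \<alpha> - snd (\<phi> t \<alpha>)) / lam) (at t within {0..}))}"

text \<open>If \<open>4 \<lambda> N B \<le> 1\<close>, where \<open>B = curvature_bound L\<close>, the system is cooperative in the variables
  \<open>(u, 2 \<lambda> v + u)\<close>, and an orbit starts from every point of \<open>damped_space \<lambda>\<close>. For \<open>N = 2\<close> the
  bound \<open>4 \<lambda> B \<le> 1\<close> alone does not imply this: solutions may leave \<open>damped_space \<lambda>\<close>. In that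
  range the existence of the semiflow has to be assumed.\<close>

text \<open>In the following, \<open>orbs\<close> is the set of forward solutions of the equation in the state space
  \<open>X\<close>. The value \<open>semiflow orbs t w\<close> is meaningful for \<open>t \<ge> 0\<close> and states \<open>w\<close> from which a
  unique forward solution in \<open>X\<close> starts.\<close>

definition semiflow :: "(real \<Rightarrow> 's) set \<Rightarrow> real \<Rightarrow> 's \<Rightarrow> 's" where
  "semiflow orbs t w = (THE p. \<exists>\<phi>\<in>orbs. \<phi> 0 = w \<and> \<phi> t = p)"

definition omega_limit :: "(real \<Rightarrow> 's::topological_space) set \<Rightarrow> 's \<Rightarrow> 's set" where
  "omega_limit orbs w =
     {p. \<exists>\<tau>. filterlim \<tau> at_top sequentially \<and> (\<lambda>n::nat. semiflow orbs (\<tau> n) w) \<longlonglongrightarrow> p}"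

definition equilibria :: "'s set \<Rightarrow> (real \<Rightarrow> 's) set \<Rightarrow> 's set" where
  "equilibria X orbs = {w \<in> X. \<forall>t\<ge>0. semiflow orbs t w = w}"

definition translate :: "int ^ 'n \<Rightarrow> (int ^ 'n \<Rightarrow> 'b) \<Rightarrow> int ^ 'n \<Rightarrow> 'b" where
  "translate \<beta> w = (\<lambda>\<alpha>. w (\<alpha> + \<beta>))"

text \<open>The set \<open>\<S>\<close>, for distinguished states \<open>w0\<close> and \<open>w1\<close>.\<close>

definition asymptotic_equilibria ::
    "(int ^ 'n \<Rightarrow> 'b::topological_space) set \<Rightarrow> (real \<Rightarrow> int ^ 'n \<Rightarrow> 'b) set \<Rightarrow>
     (int ^ 'n \<Rightarrow> 'b) \<Rightarrow> (int ^ 'n \<Rightarrow> 'b) \<Rightarrow> (int ^ 'n \<Rightarrow> 'b) set" where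
  "asymptotic_equilibria X orbs w0 w1 =
     {w0, w1} \<union>
     {w \<in> equilibria X orbs. \<exists>j. \<exists>\<epsilon>\<in>{axis j 1, - axis j 1}. \<exists>l\<in>{w0, w1}.
        (\<lambda>n. translate (int n *s \<epsilon>) w) \<longlonglongrightarrow> l}"

definition overdamped_reflect :: "(int ^ 'n \<Rightarrow> real) \<Rightarrow> int ^ 'n \<Rightarrow> real" where
  "overdamped_reflect u = (\<lambda>\<alpha>. 1 - u \<alpha>)"

definition damped_reflect :: "(int ^ 'n \<Rightarrow> real \<times> real) \<Rightarrow> int ^ 'n \<Rightarrow> real \<times> real" where
  "damped_reflect w = (\<lambda>\<alpha>. (1 - fst (w \<alpha>), - snd (w \<alpha>)))"

definition borel_probability_on :: "'s::topological_space set \<Rightarrow> 's measure \<Rightarrow> bool" where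
  "borel_probability_on X \<mu> \<longleftrightarrow>
     prob_space \<mu> \<and> space \<mu> = X \<and> sets \<mu> = sets (restrict_space borel X)"

definition invariant_under :: "('s \<Rightarrow> 's) \<Rightarrow> 's measure \<Rightarrow> bool" where
  "invariant_under f \<mu> \<longleftrightarrow> (\<forall>A\<in>sets \<mu>. measure \<mu> (f ` A) = measure \<mu> A)"

definition translation_ergodic :: "(int ^ 'n \<Rightarrow> 'b) measure \<Rightarrow> bool" where
  "translation_ergodic \<mu> \<longleftrightarrow>
     (\<forall>\<beta>. invariant_under (translate \<beta>) \<mu>) \<and>
     (\<forall>A\<in>sets \<mu>. (\<forall>\<beta>. translate \<beta> ` A = A) \<longrightarrow> measure \<mu> A \<in> {0, 1})"

end

theory Submission
  imports Defs
begin

text \<open>Along an orbit the energy density at the origin changes by a discrete divergence minus the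
  local dissipation. By translation invariance of \<open>\<mu>\<close> the divergence has expectation zero, so the
  expected dissipation is summable over unit time intervals. Hence almost surely the dissipation
  at every site tends to zero, and by compactness the \<open>\<omega>\<close>-limit set contains an equilibrium, which
  lies in \<open>\<S>\<close> by (M3).

  By ergodicity and reflection symmetry, \<open>w\<^sub>0\<close> and \<open>w\<^sub>1\<close> either both belong to \<open>\<omega>(w)\<close> almost surely
  or both almost never do. In the latter case almost every \<open>w\<close> eventually avoids a neighbourhood
  \<open>U\<close> of \<open>{w\<^sub>0, w\<^sub>1}\<close>. An equilibrium \<open>q\<close> in \<open>\<omega>(w)\<close> is then in \<open>\<S> - {w\<^sub>0, w\<^sub>1}\<close>, so its translates by
  \<open>n \<epsilon>\<close> enter \<open>U\<close> for all large \<open>n\<close>, and the translates of \<open>w\<close> by \<open>n \<epsilon>\<close> do not avoid \<open>U\<close>. This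
  contradicts Poincare recurrence for the translation by \<open>\<epsilon>\<close>.\<close>

lemma tendsto_fun_iff:
  fixes f :: "'c \<Rightarrow> 'a \<Rightarrow> 'b::topological_space"
  shows "(f \<longlongrightarrow> l) F \<longleftrightarrow> (\<forall>i. ((\<lambda>x. f x i) \<longlongrightarrow> l i) F)"
proof -
  have "(f \<longlongrightarrow> l) F \<longleftrightarrow> limitin (product_topology (\<lambda>_. euclidean) UNIV) f l F"
    by (simp add: euclidean_product_topology)
  then show ?thesis
    by (simp add: limitin_componentwise)
qed

lemma continuous_on_coordinate: "continuous_on S (\<lambda>w. w \<alpha>)"
  by (rule continuous_on_product_then_coordinatewise[OF continuous_on_id])

lemma continuous_on_translate: "continuous_on UNIV (translate \<beta>)"
  unfolding translate_def
  by (intro continuous_on_coordinatewise_then_product continuous_on_coordinate)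

lemma translate_0 [simp]: "translate 0 w = w"
  by (simp add: translate_def)

lemma translate_translate: "translate \<beta> (translate \<gamma> w) = translate (\<beta> + \<gamma>) w"
  by (simp add: translate_def add.assoc)

subsection \<open>Lattice systems with finite range\<close>

definition nbhd :: "int ^ 'n \<Rightarrow> (int ^ 'n) set" where
  "nbhd \<alpha> = {\<alpha>} \<union> range (\<lambda>j. \<alpha> + axis j 1) \<union> range (\<lambda>j. \<alpha> - axis j 1)"

lemma finite_nbhd [simp]: "finite (nbhd (\<alpha> :: int ^ 'n::finite))"
  by (simp add: nbhd_def)

fun reach :: "nat \<Rightarrow> int ^ 'n \<Rightarrow> (int ^ 'n) set" where
  "reach 0 \<alpha> = {\<alpha>}"
| "reach (Suc n) \<alpha> = (\<Union>\<beta>\<in>nbhd \<alpha>. reach n \<beta>)"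

lemma finite_reach: "finite (reach n (\<alpha> :: int ^ 'n::finite))"
  by (induction n arbitrary: \<alpha>) auto

lemma self_in_reach: "\<alpha> \<in> reach n \<alpha>"
proof (induction n)
  case (Suc n)
  have "\<alpha> \<in> nbhd \<alpha>" by (simp add: nbhd_def)
  with Suc show ?case by auto
qed auto

lemma pow_exp_tail: "(\<lambda>n. D * x ^ n / fact n :: real) \<longlonglongrightarrow> 0"
proof -
  have "(\<lambda>n. D * (inverse (fact n) * x ^ n)) \<longlonglongrightarrow> D * 0"
    by (intro tendsto_mult tendsto_const summable_LIMSEQ_zero summable_exp)
  then show ?thesis by (simp add: field_simps)
qed

locale lattice_system =
  fixes K :: "'b::euclidean_space set"
    and V :: "(int ^ 'n::finite \<Rightarrow> 'b) \<Rightarrow> int ^ 'n \<Rightarrow> 'b"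
    and C :: real
    and X :: "(int ^ 'n \<Rightarrow> 'b) set"
    and orbs :: "(real \<Rightarrow> int ^ 'n \<Rightarrow> 'b) set"
  assumes compact_K: "compact K"
    and X_eq: "X = {w. \<forall>\<alpha>. w \<alpha> \<in> K}"
    and orbs_eq: "orbs = {\<phi>. \<forall>t\<ge>0. \<phi> t \<in> X \<and>
        (\<forall>\<alpha>. ((\<lambda>s. \<phi> s \<alpha>) has_vector_derivative V (\<phi> t) \<alpha>) (at t within {0..}))}"
    and V_lipschitz: "\<And>u w \<alpha> r. u \<in> X \<Longrightarrow> w \<in> X \<Longrightarrow> (\<And>\<beta>. \<beta> \<in> nbhd \<alpha> \<Longrightarrow> norm (u \<beta> - w \<beta>) \<le> r)
        \<Longrightarrow> norm (V u \<alpha> - V w \<alpha>) \<le> C * r"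
    and V_translate: "\<And>\<beta> w. V (translate \<beta> w) = translate \<beta> (V w)"
    and orbit_exists: "\<And>w. w \<in> X \<Longrightarrow> \<exists>\<phi>\<in>orbs. \<phi> 0 = w"
begin

lemma compact_X: "compact X"
proof -
  have "X = PiE UNIV (\<lambda>_. K)" by (auto simp: X_eq)
  then have "compactin (product_topology (\<lambda>_. euclidean) UNIV) X"
    using compact_K by (simp add: compactin_PiE)
  then show ?thesis by (simp add: euclidean_product_topology)
qed

lemma translate_in_X: "w \<in> X \<Longrightarrow> translate \<beta> w \<in> X"
  by (simp add: X_eq translate_def)

lemma orbs_in_X: "\<phi> \<in> orbs \<Longrightarrow> 0 \<le> t \<Longrightarrow> \<phi> t \<in> X"
  by (auto simp: orbs_eq)

lemma orbs_deriv:
  "\<phi> \<in> orbs \<Longrightarrow> 0 \<le> t \<Longrightarrow> ((\<lambda>s. \<phi> s \<alpha>) has_vector_derivative V (\<phi> t) \<alpha>) (at t within {0..})"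
  by (auto simp: orbs_eq)

lemma orbs_cont: "\<phi> \<in> orbs \<Longrightarrow> continuous_on {0..} (\<lambda>t. \<phi> t \<alpha>)"
  by (rule continuous_on_vector_derivative[OF orbs_deriv]) auto

lemma diameter_bound:
  obtains D where "0 \<le> D" "\<And>u w \<alpha>. u \<in> X \<Longrightarrow> w \<in> X \<Longrightarrow> norm (u \<alpha> - w \<alpha>) \<le> D"
proof -
  obtain B where B: "\<And>a. a \<in> K \<Longrightarrow> norm a \<le> B" "B > 0"
    using compact_imp_bounded[OF compact_K] by (meson bounded_pos)
  show ?thesis
  proof (rule that[of "B + B"])
    fix u w \<alpha> assume "u \<in> X" "w \<in> X"
    then have "norm (u \<alpha>) \<le> B" "norm (w \<alpha>) \<le> B" using B by (auto simp: X_eq)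
    then show "norm (u \<alpha> - w \<alpha>) \<le> B + B"
      using norm_triangle_ineq4[of "u \<alpha>" "w \<alpha>"] by linarith
  qed (use B in auto)
qed

text \<open>Gronwall's inequality by iteration: a perturbation spreads by one neighbourhood per step,
  so the initial data outside a finite window contribute only the tail \<open>(C t)\<^sup>n / n!\<close>.\<close>

lemma orbit_dependence:
  assumes \<phi>: "\<phi> \<in> orbs" and \<psi>: "\<psi> \<in> orbs" and D: "0 \<le> D"
    "\<And>u w \<alpha>. u \<in> X \<Longrightarrow> w \<in> X \<Longrightarrow> norm (u \<alpha> - w \<alpha>) \<le> D"
    and m: "0 \<le> m"
  shows "0 \<le> t \<Longrightarrow> (\<And>\<beta>. \<beta> \<in> reach n \<alpha> \<Longrightarrow> norm (\<phi> 0 \<beta> - \<psi> 0 \<beta>) \<le> m) \<Longrightarrow>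
    norm (\<phi> t \<alpha> - \<psi> t \<alpha>) \<le> m * exp (C * t) + D * (C * t) ^ n / fact n"
proof (induction n arbitrary: \<alpha> t)
  case 0
  have "norm (\<phi> t \<alpha> - \<psi> t \<alpha>) \<le> D"
    using D(2) orbs_in_X[OF \<phi>] orbs_in_X[OF \<psi>] 0 by simp
  then show ?case using m by (simp add: add_increasing)
next
  case (Suc n)
  define f where "f s = \<phi> s \<alpha> - \<psi> s \<alpha>" for s
  define h where "h s = m * exp (C * s) + D * (C * s) ^ Suc n / fact (Suc n)" for s
  define h' where "h' s = C * (m * exp (C * s) + D * (C * s) ^ n / fact n)" for s
  have start: "norm (f 0) \<le> m"
    using Suc.prems(2)[OF self_in_reach] by (simp add: f_def)
  show ?case
  proof (cases "t = 0")
    case True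
    then show ?thesis using start by (simp add: f_def)
  next
    case False
    with Suc.prems have t: "0 < t" by simp
    have "norm (f t - f 0) \<le> h t - h 0"
    proof (rule differentiable_bound_general[OF t])
      show "continuous_on {0..t} f" unfolding f_def
        by (intro continuous_on_diff continuous_on_subset[OF orbs_cont[OF \<phi>]]
            continuous_on_subset[OF orbs_cont[OF \<psi>]]) auto
      show "continuous_on {0..t} h" unfolding h_def
        by (intro continuous_intros) auto
      fix s assume s: "0 < s" "s < t"
      have at: "at s within {0..} = at s"
        using s by (intro at_within_interior) auto
      show "(f has_vector_derivative V (\<phi> s) \<alpha> - V (\<psi> s) \<alpha>) (at s)"
        using orbs_deriv[OF \<phi>, of s \<alpha>] orbs_deriv[OF \<psi>, of s \<alpha>] s
        unfolding f_def at by (intro has_vector_derivative_diff) auto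
      have fact: "fact (Suc n) = real (Suc n) * fact n" by simp
      have "(h has_real_derivative m * (exp (C * s) * C) + D * (real (Suc n) * (C * s) ^ n * C) / fact (Suc n)) (at s)"
        unfolding h_def
        by (rule derivative_eq_intros refl | simp)+
      also have "m * (exp (C * s) * C) + D * (real (Suc n) * (C * s) ^ n * C) / fact (Suc n) = h' s"
        unfolding h'_def fact by (simp add: field_simps del: of_nat_Suc)
      finally show "(h has_vector_derivative h' s) (at s)"
        by (simp add: has_real_derivative_iff_has_vector_derivative)
      show "norm (V (\<phi> s) \<alpha> - V (\<psi> s) \<alpha>) \<le> h' s"
        unfolding h'_def
      proof (rule V_lipschitz)
        show "\<phi> s \<in> X" "\<psi> s \<in> X" using orbs_in_X \<phi> \<psi> s by auto
        fix \<beta> assume "\<beta> \<in> nbhd \<alpha>"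
        then show "norm (\<phi> s \<beta> - \<psi> s \<beta>) \<le> m * exp (C * s) + D * (C * s) ^ n / fact n"
          using s Suc.prems(2) by (intro Suc.IH) auto
      qed
    qed
    also have "h 0 = m" by (simp add: h_def)
    finally have "norm (f t) \<le> h t"
      using start norm_triangle_sub[of "f t" "f 0"] by linarith
    then show ?thesis by (simp add: f_def h_def)
  qed
qed

lemma orbit_unique:
  assumes \<phi>: "\<phi> \<in> orbs" and \<psi>: "\<psi> \<in> orbs" and "\<phi> 0 = \<psi> 0" "0 \<le> t"
  shows "\<phi> t = \<psi> t"
proof
  fix \<alpha>
  obtain D where D: "0 \<le> D" "\<And>u w \<alpha>. u \<in> X \<Longrightarrow> w \<in> X \<Longrightarrow> norm (u \<alpha> - w \<alpha>) \<le> D"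
    using diameter_bound by blast
  have "norm (\<phi> t \<alpha> - \<psi> t \<alpha>) \<le> D * (C * t) ^ n / fact n" for n
    using orbit_dependence[OF \<phi> \<psi>, of D 0 t n \<alpha>] D assms by simp
  then have "norm (\<phi> t \<alpha> - \<psi> t \<alpha>) \<le> 0"
    by (intro LIMSEQ_le_const[OF pow_exp_tail]) auto
  then show "\<phi> t \<alpha> = \<psi> t \<alpha>" by simp
qed

abbreviation flow :: "real \<Rightarrow> (int ^ 'n \<Rightarrow> 'b) \<Rightarrow> int ^ 'n \<Rightarrow> 'b" where
  "flow \<equiv> semiflow orbs"

lemma flow_orbit: "\<phi> \<in> orbs \<Longrightarrow> 0 \<le> t \<Longrightarrow> flow t (\<phi> 0) = \<phi> t"
  unfolding semiflow_def by (rule the_equality) (blast, metis orbit_unique)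

lemma orbs_cong: "\<phi> \<in> orbs \<Longrightarrow> (\<And>t. 0 \<le> t \<Longrightarrow> \<psi> t = \<phi> t) \<Longrightarrow> \<psi> \<in> orbs"
proof -
  assume \<phi>: "\<phi> \<in> orbs" and eq: "\<And>t. 0 \<le> t \<Longrightarrow> \<psi> t = \<phi> t"
  have "((\<lambda>s. \<psi> s \<alpha>) has_vector_derivative V (\<psi> t) \<alpha>) (at t within {0..})" if "0 \<le> t" for t \<alpha>
    using orbs_deriv[OF \<phi> that, of \<alpha>] that
    by (subst has_vector_derivative_cong_ev[where g = "\<lambda>s. \<phi> s \<alpha>"]) (auto simp: eq)
  moreover have "\<psi> t \<in> X" if "0 \<le> t" for t using orbs_in_X[OF \<phi> that] eq[OF that] by simp
  ultimately show "\<psi> \<in> orbs" unfolding orbs_eq by blast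
qed

lemma flow_orbs:
  assumes "w \<in> X"
  shows "(\<lambda>t. flow t w) \<in> orbs"
proof -
  obtain \<phi> where \<phi>: "\<phi> \<in> orbs" "\<phi> 0 = w" using orbit_exists[OF assms] by blast
  show ?thesis
    by (rule orbs_cong[OF \<phi>(1)]) (use flow_orbit[OF \<phi>(1)] \<phi>(2) in simp)
qed

lemma flow_0: "w \<in> X \<Longrightarrow> flow 0 w = w"
  using orbit_exists[of w] flow_orbit[of _ 0] by auto

lemma flow_in_X: "w \<in> X \<Longrightarrow> 0 \<le> t \<Longrightarrow> flow t w \<in> X"
  using flow_orbs orbs_in_X by blast

lemma orbs_shift: "\<phi> \<in> orbs \<Longrightarrow> 0 \<le> s \<Longrightarrow> (\<lambda>t. \<phi> (t + s)) \<in> orbs"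
proof -
  assume \<phi>: "\<phi> \<in> orbs" and s: "0 \<le> s"
  have "((\<lambda>r. \<phi> (r + s) \<alpha>) has_vector_derivative V (\<phi> (t + s)) \<alpha>) (at t within {0..})" if "0 \<le> t" for t \<alpha>
  proof -
    have shift: "((\<lambda>r. r + s) has_vector_derivative 1) (at t within {0..})"
      by (auto intro!: derivative_eq_intros)
    have "((\<lambda>r. \<phi> r \<alpha>) has_vector_derivative V (\<phi> (t + s)) \<alpha>) (at (t + s) within (\<lambda>r. r + s) ` {0..})"
      by (rule has_vector_derivative_within_subset[OF orbs_deriv[OF \<phi>]]) (use that s in auto)
    from vector_diff_chain_within[OF shift this] show ?thesis
      by (simp add: o_def)
  qed
  moreover have "\<phi> (t + s) \<in> X" if "0 \<le> t" for t using orbs_in_X[OF \<phi>] s that by simp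
  ultimately show ?thesis unfolding orbs_eq by blast
qed

lemma flow_add: "w \<in> X \<Longrightarrow> 0 \<le> s \<Longrightarrow> 0 \<le> t \<Longrightarrow> flow (t + s) w = flow t (flow s w)"
  using flow_orbit[OF orbs_shift[OF flow_orbs], of w s t] by simp

lemma orbs_translate:
  assumes \<phi>: "\<phi> \<in> orbs"
  shows "(\<lambda>t. translate \<beta> (\<phi> t)) \<in> orbs"
proof -
  have "((\<lambda>s. translate \<beta> (\<phi> s) \<alpha>) has_vector_derivative V (translate \<beta> (\<phi> t)) \<alpha>) (at t within {0..})"
    if "0 \<le> t" for t \<alpha>
    unfolding V_translate using orbs_deriv[OF \<phi> that] by (simp only: translate_def)
  then show ?thesis using translate_in_X[OF orbs_in_X[OF \<phi>]] unfolding orbs_eq by blast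
qed

lemma flow_translate: "w \<in> X \<Longrightarrow> 0 \<le> t \<Longrightarrow> flow t (translate \<beta> w) = translate \<beta> (flow t w)"
  using flow_orbit[OF orbs_translate[OF flow_orbs], of w t \<beta>] by (simp add: flow_0)

lemma continuous_on_flow:
  assumes t: "0 \<le> t"
  shows "continuous_on X (flow t)"
proof (rule continuous_on_sequentiallyI)
  fix u a assume u: "\<forall>n. u n \<in> X" and a: "a \<in> X" and lim: "u \<longlonglongrightarrow> a"
  obtain D where D: "0 \<le> D" "\<And>u w \<alpha>. u \<in> X \<Longrightarrow> w \<in> X \<Longrightarrow> norm (u \<alpha> - w \<alpha>) \<le> D"
    using diameter_bound by blast
  have "(\<lambda>n. flow t (u n) \<alpha>) \<longlonglongrightarrow> flow t a \<alpha>" for \<alpha>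
  proof (rule LIMSEQ_I)
    fix e :: real assume e: "0 < e"
    have "\<forall>\<^sub>F k in sequentially. D * (C * t) ^ k / fact k < e / 2"
      using e by (intro order_tendstoD(2)[OF pow_exp_tail]) auto
    then obtain k where k: "D * (C * t) ^ k / fact k < e / 2"
      using eventually_happens' sequentially_bot by blast
    define m where "m = e / 2 / exp (C * t)"
    have m: "0 < m" using e by (simp add: m_def)
    have "\<forall>\<^sub>F n in sequentially. \<forall>\<beta>\<in>reach k \<alpha>. norm (u n \<beta> - a \<beta>) < m"
    proof (rule eventually_ball_finite[OF finite_reach], rule)
      fix \<beta>
      have "(\<lambda>n. u n \<beta>) \<longlonglongrightarrow> a \<beta>" using lim by (simp add: tendsto_fun_iff)
      then show "\<forall>\<^sub>F n in sequentially. norm (u n \<beta> - a \<beta>) < m"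
        using m tendstoD by (fastforce simp: dist_norm)
    qed
    then obtain n0 where n0: "\<And>n \<beta>. n \<ge> n0 \<Longrightarrow> \<beta> \<in> reach k \<alpha> \<Longrightarrow> norm (u n \<beta> - a \<beta>) < m"
      unfolding eventually_sequentially by blast
    have "norm (flow t (u n) \<alpha> - flow t a \<alpha>) < e" if "n \<ge> n0" for n
    proof -
      have "norm (flow t (u n) \<alpha> - flow t a \<alpha>) \<le> m * exp (C * t) + D * (C * t) ^ k / fact k"
        using u a n0[OF that] m t
        by (intro orbit_dependence[where \<phi> = "\<lambda>t. flow t (u n)" and \<psi> = "\<lambda>t. flow t a"] flow_orbs D)
           (auto simp: flow_0 intro: less_imp_le)
      also have "m * exp (C * t) = e / 2" by (simp add: m_def)
      also have "e / 2 + D * (C * t) ^ k / fact k < e" using k by linarith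
      finally show ?thesis .
    qed
    then show "\<exists>no. \<forall>n\<ge>no. norm (flow t (u n) \<alpha> - flow t a \<alpha>) < e" by blast
  qed
  then show "(\<lambda>n. flow t (u n)) \<longlonglongrightarrow> flow t a" by (simp add: tendsto_fun_iff)
qed

lemma flow_time_cont: "w \<in> X \<Longrightarrow> continuous_on {0..} (\<lambda>t. flow t w)"
  by (intro continuous_on_coordinatewise_then_product orbs_cont flow_orbs)

lemma V_zero_equilibrium:
  assumes "w \<in> X" "V w = (\<lambda>_. 0)"
  shows "w \<in> equilibria X orbs"
proof -
  have "(\<lambda>_. w) \<in> orbs" using assms by (simp add: orbs_eq)
  from flow_orbit[OF this] show ?thesis using assms by (simp add: equilibria_def)
qed

lemma omega_limitI:
  assumes w: "w \<in> X" and "filterlim \<tau> at_top sequentially" "(\<lambda>n::nat. flow (\<tau> n) w) \<longlonglongrightarrow> p"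
  shows "p \<in> omega_limit orbs w"
  using assms by (auto simp: omega_limit_def)

lemma omega_limit_iff:
  assumes w: "w \<in> X"
  shows "p \<in> omega_limit orbs w \<longleftrightarrow> (\<forall>m::nat. \<forall>T::nat. \<exists>t\<ge>real T. dist (flow t w) p < inverse (Suc m))"
proof
  assume "p \<in> omega_limit orbs w"
  then obtain \<tau> where \<tau>: "filterlim \<tau> at_top sequentially" "(\<lambda>n::nat. flow (\<tau> n) w) \<longlonglongrightarrow> p"
    by (auto simp: omega_limit_def)
  show "\<forall>m::nat. \<forall>T::nat. \<exists>t\<ge>real T. dist (flow t w) p < inverse (Suc m)"
  proof (intro allI)
    fix m T :: nat
    have "\<forall>\<^sub>F n in sequentially. dist (flow (\<tau> n) w) p < inverse (Suc m) \<and> \<tau> n \<ge> real T"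
      using \<tau> by (intro eventually_conj tendstoD) (auto simp: filterlim_at_top)
    then show "\<exists>t\<ge>real T. dist (flow t w) p < inverse (Suc m)"
      using eventually_happens' sequentially_bot by blast
  qed
next
  assume "\<forall>m::nat. \<forall>T::nat. \<exists>t\<ge>real T. dist (flow t w) p < inverse (Suc m)"
  then have "\<forall>n::nat. \<exists>t\<ge>real n. dist (flow t w) p < inverse (Suc n)" by blast
  then obtain \<tau> where \<tau>: "\<And>n::nat. \<tau> n \<ge> real n" "\<And>n. dist (flow (\<tau> n) w) p < inverse (Suc n)"
    by metis
  have "filterlim \<tau> at_top sequentially"
    by (rule filterlim_at_top_mono[OF filterlim_real_sequentially]) (use \<tau> in auto)
  moreover have "(\<lambda>n. flow (\<tau> n) w) \<longlonglongrightarrow> p"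
  proof (subst tendsto_dist_iff, rule tendsto_sandwich[OF _ _ tendsto_const])
    show "(\<lambda>n. inverse (real (Suc n))) \<longlonglongrightarrow> 0" by (rule LIMSEQ_inverse_real_of_nat)
    show "\<forall>\<^sub>F n in sequentially. dist (flow (\<tau> n) w) p \<le> inverse (real (Suc n))"
      using \<tau>(2) by (intro always_eventually) (metis less_imp_le)
    show "\<forall>\<^sub>F n in sequentially. 0 \<le> dist (flow (\<tau> n) w) p" by simp
  qed
  ultimately show "p \<in> omega_limit orbs w" by (auto simp: omega_limit_def)
qed

lemma omega_limit_in_X: "w \<in> X \<Longrightarrow> p \<in> omega_limit orbs w \<Longrightarrow> p \<in> X"
proof -
  assume w: "w \<in> X" and "p \<in> omega_limit orbs w"
  then obtain \<tau> where \<tau>: "filterlim \<tau> at_top sequentially" "(\<lambda>n::nat. flow (\<tau> n) w) \<longlonglongrightarrow> p"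
    by (auto simp: omega_limit_def)
  have "\<forall>\<^sub>F n in sequentially. 0 \<le> \<tau> n" using \<tau>(1) by (simp add: filterlim_at_top)
  then have "\<forall>\<^sub>F n in sequentially. flow (\<tau> n) w \<in> X"
    by eventually_elim (use w flow_in_X in auto)
  then show "p \<in> X"
    using Lim_in_closed_set[OF compact_imp_closed[OF compact_X]] \<tau>(2) by fastforce
qed

lemma omega_limit_translate:
  assumes w: "w \<in> X" and p: "p \<in> omega_limit orbs w"
  shows "translate \<beta> p \<in> omega_limit orbs (translate \<beta> w)"
proof -
  obtain \<tau> where \<tau>: "filterlim \<tau> at_top sequentially" "(\<lambda>n::nat. flow (\<tau> n) w) \<longlonglongrightarrow> p"
    using p by (auto simp: omega_limit_def)
  have "\<forall>\<^sub>F n in sequentially. 0 \<le> \<tau> n" using \<tau>(1) by (simp add: filterlim_at_top)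
  then have "\<forall>\<^sub>F n in sequentially. translate \<beta> (flow (\<tau> n) w) = flow (\<tau> n) (translate \<beta> w)"
    by eventually_elim (use w flow_translate in auto)
  moreover have "(\<lambda>n. translate \<beta> (flow (\<tau> n) w)) \<longlonglongrightarrow> translate \<beta> p"
    using \<tau>(2) by (simp add: tendsto_fun_iff translate_def)
  ultimately have "(\<lambda>n. flow (\<tau> n) (translate \<beta> w)) \<longlonglongrightarrow> translate \<beta> p"
    using Lim_transform_eventually by fast
  with \<tau>(1) show ?thesis by (auto simp: omega_limit_def)
qed

end

subsection \<open>Energy dissipation and ergodicity\<close>

locale dissipative_lattice_system = lattice_system K V C X orbs
  for K :: "'b::euclidean_space set" and V :: "(int ^ 'n::finite \<Rightarrow> 'b) \<Rightarrow> int ^ 'n \<Rightarrow> 'b"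
    and C :: real and X :: "(int ^ 'n \<Rightarrow> 'b) set" and orbs :: "(real \<Rightarrow> int ^ 'n \<Rightarrow> 'b) set" +
  fixes energy dissipation :: "(int ^ 'n \<Rightarrow> 'b) \<Rightarrow> real"
    and flux :: "'n \<Rightarrow> (int ^ 'n \<Rightarrow> 'b) \<Rightarrow> real"
  assumes continuous_energy: "continuous_on X energy"
    and continuous_dissipation: "continuous_on X dissipation"
    and continuous_flux: "\<And>j. continuous_on X (flux j)"
    and dissipation_nonneg: "\<And>w. w \<in> X \<Longrightarrow> 0 \<le> dissipation w"
    and energy_balance: "\<And>\<phi> t. \<phi> \<in> orbs \<Longrightarrow> 0 \<le> t \<Longrightarrow>
      ((\<lambda>s. energy (\<phi> s)) has_real_derivative
        (\<Sum>j\<in>UNIV. flux j (\<phi> t) - flux j (translate (- axis j 1) (\<phi> t))) - dissipation (\<phi> t))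
      (at t within {0..})"
    and no_dissipation: "\<And>\<phi>. \<phi> \<in> orbs \<Longrightarrow>
      (\<And>t \<beta>. t \<in> {0..1} \<Longrightarrow> dissipation (translate \<beta> (\<phi> t)) = 0) \<Longrightarrow> V (\<phi> 0) = (\<lambda>_. 0)"
begin

definition average :: "((int ^ 'n \<Rightarrow> 'b) \<Rightarrow> real) \<Rightarrow> (int ^ 'n \<Rightarrow> 'b) \<Rightarrow> real" where
  "average f w = integral {0..1} (\<lambda>t. f (flow t w))"

lemma flow_observable_cont:
  assumes "continuous_on X f" "w \<in> X"
  shows "continuous_on {0..1} (\<lambda>t. f (flow t w))"
  by (rule continuous_on_compose2[OF assms(1)])
     (use assms(2) flow_in_X continuous_on_subset[OF flow_time_cont] in auto)

lemma X_bounded: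
  assumes "continuous_on X (f :: _ \<Rightarrow> real)"
  obtains B where "\<And>w. w \<in> X \<Longrightarrow> \<bar>f w\<bar> \<le> B"
proof -
  have "bounded (f ` X)"
    by (intro compact_imp_bounded compact_continuous_image assms compact_X)
  then show ?thesis using that by (auto simp: bounded_iff)
qed

lemma continuous_on_average:
  assumes f: "continuous_on X f"
  shows "continuous_on X (average f)"
proof (rule continuous_on_sequentiallyI)
  fix u a assume u: "\<forall>n. u n \<in> X" and a: "a \<in> X" and lim: "u \<longlonglongrightarrow> a"
  obtain B where B: "\<And>w. w \<in> X \<Longrightarrow> \<bar>f w\<bar> \<le> B" using X_bounded[OF f] by blast
  show "(\<lambda>n. average f (u n)) \<longlonglongrightarrow> average f a"
    unfolding average_def
  proof (rule dominated_convergence(2))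
    show "(\<lambda>t. f (flow t (u k))) integrable_on {0..1}" for k
      using flow_observable_cont[OF f] u by (blast intro: integrable_continuous_real)
    show "(\<lambda>t::real. B) integrable_on {0..1}" by (rule integrable_const_ivl)
    show "norm (f (flow t (u k))) \<le> B" if "t \<in> {0..1}" for k t
      using B[OF flow_in_X] u that by simp
    fix t :: real assume t: "t \<in> {0..1}"
    then have "continuous_on X (\<lambda>w. f (flow t w))"
      by (intro continuous_on_compose2[OF f] continuous_on_flow) (auto simp: flow_in_X)
    then show "(\<lambda>k. f (flow t (u k))) \<longlonglongrightarrow> f (flow t a)"
      using u a lim unfolding continuous_on_sequentially by (auto simp: o_def)
  qed
qed

lemma average_dissipation:
  assumes w: "w \<in> X"
  shows "average dissipation w = energy w - energy (flow 1 w)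
    + (\<Sum>j\<in>UNIV. average (flux j) w - average (flux j) (translate (- axis j 1) w))"
proof -
  have int: "((\<lambda>t. f (flow t w)) has_integral average f w) {0..1}" if "continuous_on X f" for f
    unfolding average_def using flow_observable_cont[OF that w]
    by (intro integrable_integral integrable_continuous_real)
  have intT: "((\<lambda>t. f (translate \<beta> (flow t w))) has_integral average f (translate \<beta> w)) {0..1}"
    if "continuous_on X f" for f \<beta>
  proof -
    have "((\<lambda>t. f (flow t (translate \<beta> w))) has_integral average f (translate \<beta> w)) {0..1}"
      unfolding average_def using flow_observable_cont[OF that translate_in_X[OF w]]
      by (intro integrable_integral integrable_continuous_real)
    then show ?thesis
      by (rule has_integral_eq[rotated]) (simp add: flow_translate w)
  qed
  have "((\<lambda>t. (\<Sum>j\<in>UNIV. flux j (flow t w) - flux j (translate (- axis j 1) (flow t w))) - dissipation (flow t w))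
      has_integral energy (flow 1 w) - energy (flow 0 w)) {0..1}"
    using energy_balance[OF flow_orbs[OF w]]
    by (intro fundamental_theorem_of_calculus)
       (auto simp: has_real_derivative_iff_has_vector_derivative intro!: has_vector_derivative_within_subset[of _ _ _ "{0..}" "{0..1}"])
  moreover have "((\<lambda>t. (\<Sum>j\<in>UNIV. flux j (flow t w) - flux j (translate (- axis j 1) (flow t w))) - dissipation (flow t w))
      has_integral (\<Sum>j\<in>UNIV. average (flux j) w - average (flux j) (translate (- axis j 1) w)) - average dissipation w) {0..1}"
    by (intro has_integral_diff has_integral_sum int intT continuous_flux continuous_dissipation) auto
  ultimately have "energy (flow 1 w) - energy (flow 0 w) =
     (\<Sum>j\<in>UNIV. average (flux j) w - average (flux j) (translate (- axis j 1) w)) - average dissipation w"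
    by (rule has_integral_unique)
  then show ?thesis using flow_0[OF w] by simp
qed

lemma average_dissipation_nonneg: "w \<in> X \<Longrightarrow> 0 \<le> average dissipation w"
  unfolding average_def
  by (intro integral_nonneg integrable_continuous_real flow_observable_cont continuous_dissipation)
     (auto intro: dissipation_nonneg flow_in_X)

lemma average_dissipation_zero:
  assumes w: "w \<in> X" and zero: "\<And>\<beta>. average dissipation (translate \<beta> w) = 0"
  shows "w \<in> equilibria X orbs"
proof (rule V_zero_equilibrium[OF w])
  have "dissipation (translate \<beta> (flow t w)) = 0" if "t \<in> {0..1}" for t \<beta>
  proof -
    note wb = translate_in_X[OF w, of \<beta>]
    have "((\<lambda>t. dissipation (flow t (translate \<beta> w))) has_integral 0) (cbox 0 1)"
      using zero[of \<beta>] integrable_integral[OF integrable_continuous_real[OF flow_observable_cont[OF continuous_dissipation wb]]]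
      by (simp add: average_def)
    then have "dissipation (flow t (translate \<beta> w)) = 0"
      by (intro has_integral_0_cbox_imp_0[of 0 1 "\<lambda>t. dissipation (flow t (translate \<beta> w))"])
         (use flow_observable_cont[OF continuous_dissipation wb] that
            dissipation_nonneg[OF flow_in_X[OF wb]] in auto)
    then show ?thesis using flow_translate[OF w] that by simp
  qed
  then have "V (flow 0 w) = (\<lambda>_. 0)"
    by (rule no_dissipation[OF flow_orbs[OF w]])
  then show "V w = (\<lambda>_. 0)" by (simp add: flow_0 w)
qed

context
  fixes \<mu> :: "(int ^ 'n \<Rightarrow> 'b) measure"
  assumes borel: "borel_probability_on X \<mu>" and ergodic: "translation_ergodic \<mu>"
begin

interpretation prob_space \<mu>
  using borel by (simp add: borel_probability_on_def)

lemma space_eq: "space \<mu> = X"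
  using borel by (simp add: borel_probability_on_def)

lemma sets_eq: "sets \<mu> = sets (restrict_space borel X)"
  using borel by (simp add: borel_probability_on_def)

lemma continuous_imp_measurable: "continuous_on X f \<Longrightarrow> f \<in> borel_measurable \<mu>"
  using borel_measurable_continuous_on_restrict measurable_cong_sets[OF sets_eq refl] by blast

lemma measurable_self:
  assumes "continuous_on X f" "f \<in> X \<rightarrow> X"
  shows "f \<in> measurable \<mu> \<mu>"
proof -
  have "f \<in> measurable \<mu> (restrict_space borel X)"
    using assms by (intro measurable_restrict_space2 continuous_imp_measurable) (auto simp: space_eq)
  then show ?thesis using measurable_cong_sets[OF refl sets_eq] by blast
qed

lemma measurable_flow: "0 \<le> t \<Longrightarrow> flow t \<in> measurable \<mu> \<mu>"
  by (intro measurable_self continuous_on_flow) (auto simp: flow_in_X)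

lemma measurable_translate: "translate \<beta> \<in> measurable \<mu> \<mu>"
  by (intro measurable_self continuous_on_subset[OF continuous_on_translate]) (auto simp: translate_in_X)

lemma translate_image: "A \<subseteq> X \<Longrightarrow> translate \<beta> ` A = translate (- \<beta>) -` A \<inter> X"
proof safe
  fix w assume A: "A \<subseteq> X" "translate (- \<beta>) w \<in> A"
  have "w = translate \<beta> (translate (- \<beta>) w)" by (simp add: translate_translate)
  with A show "w \<in> translate \<beta> ` A" by blast
qed (auto simp: translate_translate translate_in_X)

lemma measure_translate_vimage:
  assumes A: "A \<in> sets \<mu>"
  shows "measure \<mu> (translate \<beta> -` A \<inter> X) = measure \<mu> A"
proof -
  have "A \<subseteq> X" using sets.sets_into_space[OF A] space_eq by simp
  from translate_image[OF this, of "- \<beta>"]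
  have "translate \<beta> -` A \<inter> X = translate (- \<beta>) ` A" by simp
  then show ?thesis using ergodic A by (simp add: translation_ergodic_def invariant_under_def)
qed

lemma distr_translate: "distr \<mu> \<mu> (translate \<beta>) = \<mu>"
proof (rule measure_eqI)
  fix A assume "A \<in> sets (distr \<mu> \<mu> (translate \<beta>))"
  then have A: "A \<in> sets \<mu>" by simp
  have "emeasure (distr \<mu> \<mu> (translate \<beta>)) A = emeasure \<mu> (translate \<beta> -` A \<inter> X)"
    using emeasure_distr[OF measurable_translate A] by (simp add: space_eq)
  also have "\<dots> = emeasure \<mu> A"
    using measure_translate_vimage[OF A] by (simp add: emeasure_eq_measure)
  finally show "emeasure (distr \<mu> \<mu> (translate \<beta>)) A = emeasure \<mu> A" .
qed simp

lemma AE_translate: "AE w in \<mu>. P w \<Longrightarrow> AE w in \<mu>. P (translate \<beta> w)"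
  using AE_distrD[OF measurable_translate[of \<beta>], of P] unfolding distr_translate by blast

lemma integral_translate:
  "f \<in> borel_measurable \<mu> \<Longrightarrow> (\<integral>w. f (translate \<beta> w) \<partial>\<mu>) = (\<integral>w. f w \<partial>\<mu> :: real)"
  using integral_distr[OF measurable_translate[of \<beta>], of f] by (simp add: distr_translate)

lemma integrable_flow:
  assumes f: "continuous_on X f" and t: "0 \<le> t"
  shows "integrable \<mu> (\<lambda>w. f (flow t w) :: real)"
proof -
  obtain B where B: "\<And>w. w \<in> X \<Longrightarrow> \<bar>f w\<bar> \<le> B" using X_bounded[OF f] by blast
  show ?thesis
  proof (rule integrable_const_bound[where B = B])
    show "AE w in \<mu>. norm (f (flow t w)) \<le> B"
      using B flow_in_X t by (intro AE_I2) (auto simp: space_eq)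
    show "(\<lambda>w. f (flow t w)) \<in> borel_measurable \<mu>"
      using measurable_compose[OF measurable_flow[OF t] continuous_imp_measurable[OF f]] .
  qed
qed

text \<open>By translation invariance the flux terms cancel in expectation.\<close>

lemma expected_dissipation:
  "(\<integral>w. average dissipation (flow (real k) w) \<partial>\<mu>)
    = (\<integral>w. energy (flow (real k) w) \<partial>\<mu>) - (\<integral>w. energy (flow (real (Suc k)) w) \<partial>\<mu>)"
proof -
  let ?F = "\<lambda>j w. average (flux j) (flow (real k) w)"
  have F: "integrable \<mu> (?F j)" for j
    by (intro integrable_flow continuous_on_average continuous_flux) simp
  have FT: "integrable \<mu> (\<lambda>w. ?F j (translate \<beta> w))" for j \<beta>
    using integrable_distr[OF measurable_translate[of \<beta>], of "?F j"] F by (simp add: distr_translate)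
  have E: "integrable \<mu> (\<lambda>w. energy (flow (real k) w))" for k
    by (intro integrable_flow continuous_energy) simp
  have "(\<integral>w. average dissipation (flow (real k) w) \<partial>\<mu>)
    = (\<integral>w. energy (flow (real k) w) - energy (flow (real (Suc k)) w)
        + (\<Sum>j\<in>UNIV. ?F j w - ?F j (translate (- axis j 1) w)) \<partial>\<mu>)"
  proof (rule Bochner_Integration.integral_cong[OF refl])
    fix w assume "w \<in> space \<mu>"
    then have w: "w \<in> X" by (simp add: space_eq)
    have "flow 1 (flow (real k) w) = flow (real (Suc k)) w"
      using flow_add[OF w, of "real k" 1] by simp
    then show "average dissipation (flow (real k) w) = energy (flow (real k) w) - energy (flow (real (Suc k)) w)
        + (\<Sum>j\<in>UNIV. ?F j w - ?F j (translate (- axis j 1) w))"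
      using average_dissipation[OF flow_in_X[OF w, of "real k"]] flow_translate[OF w, of "real k"] by simp
  qed
  also have "\<dots> = (\<integral>w. energy (flow (real k) w) \<partial>\<mu>) - (\<integral>w. energy (flow (real (Suc k)) w) \<partial>\<mu>)
        + (\<Sum>j\<in>UNIV. (\<integral>w. ?F j w \<partial>\<mu>) - (\<integral>w. ?F j (translate (- axis j 1) w) \<partial>\<mu>))"
    by (simp add: E F FT del: of_nat_Suc)
  also have "(\<Sum>j\<in>UNIV. (\<integral>w. ?F j w \<partial>\<mu>) - (\<integral>w. ?F j (translate (- axis j 1) w) \<partial>\<mu>)) = 0"
    using integral_translate[OF borel_measurable_integrable[OF F]] by simp
  finally show ?thesis by simp
qed

lemma AE_dissipation_vanishes: "AE w in \<mu>. (\<lambda>k. average dissipation (flow (real k) w)) \<longlonglongrightarrow> 0"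
proof -
  let ?D = "\<lambda>k w. average dissipation (flow (real k) w)"
  obtain B where B: "\<And>w. w \<in> X \<Longrightarrow> \<bar>energy w\<bar> \<le> B" using X_bounded[OF continuous_energy] by blast
  have D_int: "integrable \<mu> (?D k)" for k
    by (intro integrable_flow continuous_on_average continuous_dissipation) simp
  have D_nonneg: "0 \<le> ?D k w" if "w \<in> space \<mu>" for k w
    using average_dissipation_nonneg[OF flow_in_X] that by (simp add: space_eq)
  have E_bound: "\<bar>\<integral>w. energy (flow (real k) w) \<partial>\<mu>\<bar> \<le> B" for k
  proof -
    have "\<bar>\<integral>w. energy (flow (real k) w) \<partial>\<mu>\<bar> \<le> (\<integral>w. \<bar>energy (flow (real k) w)\<bar> \<partial>\<mu>)"
      by (rule integral_abs_bound)
    also have "\<dots> \<le> (\<integral>w. B \<partial>\<mu>)"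
      using B flow_in_X by (intro integral_mono integrable_abs integrable_flow continuous_energy) (auto simp: space_eq)
    finally show ?thesis by (simp add: prob_space)
  qed
  have "(\<Sum>k<n. \<integral>w. ?D k w \<partial>\<mu>) \<le> 2 * B" for n
  proof -
    have "(\<Sum>k<n. \<integral>w. ?D k w \<partial>\<mu>) = (\<integral>w. energy (flow (real 0) w) \<partial>\<mu>) - (\<integral>w. energy (flow (real n) w) \<partial>\<mu>)"
      unfolding expected_dissipation by (rule sum_lessThan_telescope')
    then show ?thesis using E_bound[of 0] E_bound[of n] by linarith
  qed
  then have summable: "summable (\<lambda>k. \<integral>w. ?D k w \<partial>\<mu>)"
    by (intro summableI_nonneg_bounded integral_nonneg_AE AE_I2 D_nonneg)
  have "(\<integral>\<^sup>+w. (\<Sum>k. ennreal (?D k w)) \<partial>\<mu>) = (\<Sum>k. \<integral>\<^sup>+w. ennreal (?D k w) \<partial>\<mu>)"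
    using borel_measurable_integrable[OF D_int] by (intro nn_integral_suminf) simp
  also have "\<dots> = (\<Sum>k. ennreal (\<integral>w. ?D k w \<partial>\<mu>))"
    using D_int D_nonneg by (intro suminf_cong nn_integral_eq_integral AE_I2)
  also have "\<dots> \<noteq> \<infinity>"
    using ennreal_suminf_neq_top[OF summable integral_nonneg_AE[OF AE_I2[OF D_nonneg]]] by simp
  finally have "AE w in \<mu>. (\<Sum>k. ennreal (?D k w)) \<noteq> \<infinity>"
    using borel_measurable_integrable[OF D_int] by (intro nn_integral_PInf_AE) simp_all
  then show ?thesis
  proof (rule AE_mp, intro AE_I2 impI)
    fix w assume "w \<in> space \<mu>" "(\<Sum>k. ennreal (?D k w)) \<noteq> \<infinity>"
    then show "(\<lambda>k. ?D k w) \<longlonglongrightarrow> 0"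
      using D_nonneg by (intro summable_LIMSEQ_zero summable_suminf_not_top) auto
  qed
qed

lemma AE_omega_equilibrium: "AE w in \<mu>. omega_limit orbs w \<inter> equilibria X orbs \<noteq> {}"
proof -
  have "AE w in \<mu>. \<forall>\<beta>. (\<lambda>k. average dissipation (flow (real k) (translate \<beta> w))) \<longlonglongrightarrow> 0"
    unfolding AE_all_countable using AE_translate[OF AE_dissipation_vanishes] by blast
  then show ?thesis
  proof (rule AE_mp, intro AE_I2 impI)
    fix w assume "w \<in> space \<mu>"
      and lim: "\<forall>\<beta>. (\<lambda>k. average dissipation (flow (real k) (translate \<beta> w))) \<longlonglongrightarrow> 0"
    then have w: "w \<in> X" by (simp add: space_eq)
    have "\<forall>k. flow (real k) w \<in> X" using flow_in_X[OF w] by simp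
    from seq_compactE[OF compact_imp_seq_compact[OF compact_X] this] obtain p r where p: "p \<in> X" and r: "strict_mono (r :: nat \<Rightarrow> nat)"
      and "((\<lambda>k. flow (real k) w) \<circ> r) \<longlonglongrightarrow> p"
      by metis
    then have conv: "(\<lambda>k. flow (real (r k)) w) \<longlonglongrightarrow> p" by (simp add: o_def)
    have "filterlim (\<lambda>k. real (r k)) at_top sequentially"
      using filterlim_compose[OF filterlim_real_sequentially filterlim_subseq[OF r]] .
    from omega_limitI[OF w this conv] have "p \<in> omega_limit orbs w" .
    moreover have "p \<in> equilibria X orbs"
    proof (rule average_dissipation_zero[OF p])
      fix \<beta>
      have "continuous_on X (\<lambda>w. average dissipation (translate \<beta> w))"
        by (intro continuous_on_compose2[OF continuous_on_average[OF continuous_dissipation]]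
            continuous_on_subset[OF continuous_on_translate]) (auto simp: translate_in_X)
      then have lim1: "(\<lambda>k. average dissipation (translate \<beta> (flow (real (r k)) w))) \<longlonglongrightarrow> average dissipation (translate \<beta> p)"
        by (rule continuous_on_tendsto_compose[OF _ conv p])
           (simp add: flow_in_X[OF w])
      have lim2: "(\<lambda>k. average dissipation (translate \<beta> (flow (real (r k)) w))) \<longlonglongrightarrow> 0"
        using LIMSEQ_subseq_LIMSEQ[OF lim[rule_format, of \<beta>] r] flow_translate[OF w, of _ \<beta>]
        unfolding o_def by simp
      show "average dissipation (translate \<beta> p) = 0"
        using LIMSEQ_unique[OF lim1 lim2] .
    qed
    ultimately show "omega_limit orbs w \<inter> equilibria X orbs \<noteq> {}" by blast
  qed
qed

lemma sets_visits:
  assumes U: "open U" and T: "0 \<le> T"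
  shows "{w \<in> X. \<exists>t\<ge>T. flow t w \<in> U} \<in> sets \<mu>"
proof -
  have "openin (top_of_set X) (\<Union>t\<in>{T..}. X \<inter> flow t -` U)"
    using T U by (intro openin_Union) (auto intro!: continuous_openin_preimage_gen continuous_on_flow)
  moreover have "(\<Union>t\<in>{T..}. X \<inter> flow t -` U) = {w \<in> X. \<exists>t\<ge>T. flow t w \<in> U}" by auto
  ultimately obtain W where "open W" "{w \<in> X. \<exists>t\<ge>T. flow t w \<in> U} = X \<inter> W"
    by (auto simp: openin_open)
  then show ?thesis by (auto simp: sets_eq sets_restrict_space)
qed

lemma sets_omega: "{w \<in> X. p \<in> omega_limit orbs w} \<in> sets \<mu>"
proof -
  have "{w \<in> X. p \<in> omega_limit orbs w}
    = (\<Inter>m::nat. \<Inter>T::nat. {w \<in> X. \<exists>t\<ge>real T. flow t w \<in> ball p (inverse (Suc m))})"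
    using omega_limit_iff by (auto simp: dist_commute)
  also have "\<dots> \<in> sets \<mu>"
    by (intro sets.countable_INT' image_subsetI sets_visits) auto
  finally show ?thesis .
qed

lemma sets_eventually_avoids:
  assumes "open U"
  shows "{w \<in> X. \<exists>T::nat. \<forall>t\<ge>real T. flow t w \<notin> U} \<in> sets \<mu>"
proof -
  have "{w \<in> X. \<exists>T::nat. \<forall>t\<ge>real T. flow t w \<notin> U}
    = X - (\<Inter>T::nat. {w \<in> X. \<exists>t\<ge>real T. flow t w \<in> U})"
    by auto
  also have "\<dots> \<in> sets \<mu>"
    using sets.top[of \<mu>] assms
    by (intro sets.Diff sets.countable_INT' image_subsetI sets_visits) (auto simp: space_eq)
  finally show ?thesis .
qed

lemma poincare_recurrence:
  assumes G: "G \<in> sets \<mu>"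
  shows "AE w in \<mu>. w \<in> G \<longrightarrow> (\<forall>n0. \<exists>n\<ge>n0. translate (int n *s \<epsilon>) w \<in> G)"
proof -
  define R where "R n = {w \<in> X. \<exists>k\<ge>n. translate (int k *s \<epsilon>) w \<in> G}" for n
  have R_sets: "R n \<in> sets \<mu>" for n
  proof -
    have "R n = (\<Union>k\<in>{n..}. translate (int k *s \<epsilon>) -` G \<inter> space \<mu>)"
      by (auto simp: R_def space_eq)
    also have "\<dots> \<in> sets \<mu>"
      by (intro sets.countable_UN'' measurable_sets[OF measurable_translate G]) auto
    finally show ?thesis .
  qed
  have "R (Suc n) = translate \<epsilon> -` R n \<inter> X" for n
  proof -
    have shift: "translate (int k *s \<epsilon>) (translate \<epsilon> w) = translate (int (Suc k) *s \<epsilon>) w" for k w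
    proof -
      have "int k *s \<epsilon> + \<epsilon> = int (Suc k) *s \<epsilon>"
        by (simp add: vec_eq_iff algebra_simps)
      then show ?thesis by (simp only: translate_translate)
    qed
    have "(\<exists>k\<ge>Suc n. P k) \<longleftrightarrow> (\<exists>k\<ge>n. P (Suc k))" for P
      by (metis Suc_le_D Suc_le_mono)
    then show ?thesis
      unfolding R_def by (auto simp: shift translate_in_X)
  qed
  then have "measure \<mu> (R n) = measure \<mu> (R 0)" for n
    by (induction n) (simp_all add: measure_translate_vimage R_sets)
  then have "measure \<mu> (R 0 - R n) = 0" for n
    by (subst finite_measure_Diff[OF R_sets R_sets]) (auto simp: R_def)
  then have "AE w in \<mu>. w \<notin> R 0 - R n" for n
    by (intro AE_not_in null_setsI) (auto simp: emeasure_eq_measure R_sets)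
  then have "AE w in \<mu>. \<forall>n. w \<notin> R 0 - R n" unfolding AE_all_countable by blast
  then show ?thesis
  proof (rule AE_mp, intro AE_I2 impI allI)
    fix w n0 assume w: "w \<in> space \<mu>" "\<forall>n. w \<notin> R 0 - R n" "w \<in> G"
    then have "w \<in> R 0" by (auto simp: R_def space_eq intro!: exI[of _ 0])
    with w(2) have "w \<in> R n0" by blast
    then show "\<exists>n\<ge>n0. translate (int n *s \<epsilon>) w \<in> G" by (auto simp: R_def)
  qed
qed

theorem AE_omega_contains:
  assumes p: "\<And>\<beta>. translate \<beta> p0 = p0"
    and R: "continuous_on X R" "\<And>w. R (R w) = w" "\<And>w. w \<in> X \<Longrightarrow> R w \<in> X" "R p0 = p1"
    and R_orbs: "\<And>\<phi>. \<phi> \<in> orbs \<Longrightarrow> (\<lambda>t. R (\<phi> t)) \<in> orbs"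
    and R_inv: "invariant_under R \<mu>"
    and M3: "AE w in \<mu>. omega_limit orbs w \<inter> (equilibria X orbs - asymptotic_equilibria X orbs p0 p1) = {}"
  shows "AE w in \<mu>. p0 \<in> omega_limit orbs w \<and> p1 \<in> omega_limit orbs w"
proof -
  define A where "A p = {w \<in> X. p \<in> omega_limit orbs w}" for p
  have A_sets: "A p \<in> sets \<mu>" for p unfolding A_def by (rule sets_omega)
  have flow_R: "flow t (R w) = R (flow t w)" if "w \<in> X" "0 \<le> t" for t w
    using flow_orbit[OF R_orbs[OF flow_orbs[OF that(1)]] that(2)] flow_0[OF that(1)] by simp
  have omega_R: "R q \<in> omega_limit orbs (R w)" if w: "w \<in> X" and q: "q \<in> omega_limit orbs w" for q w
  proof -
    obtain \<tau> where \<tau>: "filterlim \<tau> at_top sequentially" "(\<lambda>n::nat. flow (\<tau> n) w) \<longlonglongrightarrow> q"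
      using q by (auto simp: omega_limit_def)
    have nonneg: "\<forall>\<^sub>F n in sequentially. 0 \<le> \<tau> n" using \<tau>(1) by (simp add: filterlim_at_top)
    then have eq: "\<forall>\<^sub>F n in sequentially. R (flow (\<tau> n) w) = flow (\<tau> n) (R w)"
      by eventually_elim (use w flow_R in auto)
    have "\<forall>\<^sub>F n in sequentially. flow (\<tau> n) w \<in> X"
      using nonneg by eventually_elim (use w flow_in_X in auto)
    then have "(\<lambda>n. R (flow (\<tau> n) w)) \<longlonglongrightarrow> R q"
      using continuous_on_tendsto_compose[OF R(1) \<tau>(2) omega_limit_in_X[OF w q]] by simp
    from Lim_transform_eventually[OF this eq] \<tau>(1) show ?thesis by (auto simp: omega_limit_def)
  qed
  have "R ` A p0 = A p1"
  proof
    show "R ` A p0 \<subseteq> A p1" using omega_R R(3,4) by (auto simp: A_def)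
    show "A p1 \<subseteq> R ` A p0"
    proof
      fix w assume "w \<in> A p1"
      then have "R w \<in> A p0" using omega_R[of w p1] R(2,3) R(2)[of p0] R(4) by (auto simp: A_def)
      then show "w \<in> R ` A p0" using R(2)[of w] by (metis imageI)
    qed
  qed
  then have meas: "measure \<mu> (A p1) = measure \<mu> (A p0)"
    using R_inv A_sets by (metis invariant_under_def)
  have trans_A: "translate \<beta> ` A p0 = A p0" for \<beta>
  proof -
    have sub: "translate \<beta> ` A p0 \<subseteq> A p0" for \<beta>
      using omega_limit_translate[of _ p0 \<beta>] p[of \<beta>] translate_in_X by (auto simp: A_def)
    have "A p0 \<subseteq> translate \<beta> ` A p0"
    proof
      fix w assume "w \<in> A p0"
      then have "translate (- \<beta>) w \<in> A p0" using sub[of "- \<beta>"] by blast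
      then have "translate \<beta> (translate (- \<beta>) w) \<in> translate \<beta> ` A p0" by (rule imageI)
      then show "w \<in> translate \<beta> ` A p0" by (simp add: translate_translate)
    qed
    with sub show ?thesis by blast
  qed
  then have "measure \<mu> (A p0) \<in> {0, 1}"
    using ergodic A_sets unfolding translation_ergodic_def by blast
  then consider (full) "measure \<mu> (A p0) = 1" | (null) "measure \<mu> (A p0) = 0" by blast
  then show ?thesis
  proof cases
    case full
    then have "AE w in \<mu>. w \<in> A p0" "AE w in \<mu>. w \<in> A p1"
      using meas prob_eq_1[OF A_sets[of p0]] prob_eq_1[OF A_sets[of p1]] by simp_all
    then show ?thesis by eventually_elim (auto simp: A_def)
  next
    case null
    then have "AE w in \<mu>. w \<notin> A p0" "AE w in \<mu>. w \<notin> A p1"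
      using meas A_sets by (auto intro!: AE_not_in null_setsI simp: emeasure_eq_measure)
    define U where "U m = ball p0 (inverse (real (Suc m))) \<union> ball p1 (inverse (real (Suc m)))" for m
    define G where "G m = {w \<in> X. \<exists>T::nat. \<forall>t\<ge>real T. flow t w \<notin> U m}" for m
    have U_open: "open (U m)" for m by (auto simp: U_def)
    have G_sets: "G m \<in> sets \<mu>" for m unfolding G_def using U_open by (rule sets_eventually_avoids)
    have cover: "\<exists>m. w \<in> G m" if w: "w \<in> X" "w \<notin> A p0" "w \<notin> A p1" for w
    proof -
      obtain m0 T0 :: nat where 0: "\<And>t. t \<ge> real T0 \<Longrightarrow> dist (flow t w) p0 \<ge> inverse (Suc m0)"
        using w omega_limit_iff[OF w(1), of p0] by (auto simp: A_def not_less)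
      obtain m1 T1 :: nat where 1: "\<And>t. t \<ge> real T1 \<Longrightarrow> dist (flow t w) p1 \<ge> inverse (Suc m1)"
        using w omega_limit_iff[OF w(1), of p1] by (auto simp: A_def not_less)
      define m where "m = max m0 m1"
      have "inverse (real (Suc m)) \<le> inverse (real (Suc m0))" "inverse (real (Suc m)) \<le> inverse (real (Suc m1))"
        by (simp_all add: m_def le_imp_inverse_le)
      note le = this
      have "flow t w \<notin> U m" if "t \<ge> real (max T0 T1)" for t
      proof -
        have "inverse (real (Suc m)) \<le> dist p0 (flow t w)" "inverse (real (Suc m)) \<le> dist p1 (flow t w)"
          using order_trans[OF le(1) 0[of t]] order_trans[OF le(2) 1[of t]] that
          by (simp_all only: dist_commute of_nat_max max.bounded_iff)
        then show ?thesis by (simp add: U_def)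
      qed
      with w(1) have "w \<in> G m" unfolding G_def by blast
      then show ?thesis ..
    qed
    have "AE w in \<mu>. \<forall>m. \<forall>\<epsilon>. w \<in> G m \<longrightarrow> (\<forall>n0. \<exists>n\<ge>n0. translate (int n *s \<epsilon>) w \<in> G m)"
      unfolding AE_all_countable using poincare_recurrence[OF G_sets] by blast
    then have "AE w in \<mu>. False"
      using \<open>AE w in \<mu>. w \<notin> A p0\<close> \<open>AE w in \<mu>. w \<notin> A p1\<close> AE_omega_equilibrium M3 AE_space
    proof eventually_elim
      case (elim w)
      then have w: "w \<in> X" by (simp add: space_eq)
      obtain m where m: "w \<in> G m" using cover w elim by blast
      obtain q where q: "q \<in> omega_limit orbs w" "q \<in> equilibria X orbs" using elim by blast
      with elim have "q \<in> asymptotic_equilibria X orbs p0 p1" by blast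
      moreover have "q \<noteq> p0" "q \<noteq> p1" using elim q w by (auto simp: A_def)
      ultimately obtain \<epsilon> l where l: "l \<in> {p0, p1}" "(\<lambda>n. translate (int n *s \<epsilon>) q) \<longlonglongrightarrow> l"
        unfolding asymptotic_equilibria_def by blast
      have "l \<in> U m" using l by (auto simp: U_def)
      from topological_tendstoD[OF l(2) U_open this]
      obtain n0 where n0: "\<And>n. n \<ge> n0 \<Longrightarrow> translate (int n *s \<epsilon>) q \<in> U m"
        unfolding eventually_sequentially by blast
      obtain n where n: "n \<ge> n0" "translate (int n *s \<epsilon>) w \<in> G m" using elim m by blast
      define w' where "w' = translate (int n *s \<epsilon>) w"
      obtain T :: nat where T: "\<And>t. t \<ge> real T \<Longrightarrow> flow t w' \<notin> U m"
        using n(2) by (auto simp: G_def w'_def)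
      obtain \<tau> where \<tau>: "filterlim \<tau> at_top sequentially"
          "(\<lambda>k::nat. flow (\<tau> k) w') \<longlonglongrightarrow> translate (int n *s \<epsilon>) q"
        using omega_limit_translate[OF w q(1), of "int n *s \<epsilon>"] by (auto simp: omega_limit_def w'_def)
      have "\<forall>\<^sub>F k in sequentially. flow (\<tau> k) w' \<in> U m \<and> real T \<le> \<tau> k"
        using topological_tendstoD[OF \<tau>(2) U_open n0[OF n(1)]] \<tau>(1)
        by (auto intro: eventually_conj simp: filterlim_at_top)
      then obtain k where "flow (\<tau> k) w' \<in> U m" "real T \<le> \<tau> k"
        using eventually_happens' sequentially_bot by blast
      with T show False by blast
    qed
    then show ?thesis by simp
  qed
qed

end

end

subsection \<open>Existence of solutions in the cube\<close>

definition duhamel :: "real \<Rightarrow> real \<Rightarrow> (real \<Rightarrow> real) \<Rightarrow> real \<Rightarrow> real" where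
  "duhamel M a g t = exp (- (M * t)) * (a + integral {0..t} (\<lambda>s. M * exp (M * s) * g s))"

lemma duhamel_0 [simp]: "duhamel M a g 0 = a"
  by (simp add: duhamel_def)

lemma continuous_duhamel_integrand:
  assumes "continuous_on {0..} g"
  shows "continuous_on {0..t} (\<lambda>s. M * exp (M * s) * g s :: real)"
  by (intro continuous_intros continuous_on_subset[OF assms]) auto

lemma duhamel_deriv:
  assumes g: "continuous_on {0..} g" and t: "0 \<le> t"
  shows "(duhamel M a g has_real_derivative M * (g t - duhamel M a g t)) (at t within {0..})"
proof -
  let ?h = "\<lambda>s. M * exp (M * s) * g s"
  have "((\<lambda>x. integral {0..x} ?h) has_real_derivative ?h t) (at t within {0..t + 1})"
    using t by (intro integral_has_real_derivative continuous_duhamel_integrand g) auto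
  also have "at t within {0..t + 1} = at t within {0..}"
    by (rule at_within_nhd[of _ "{..<t + 1}"]) auto
  finally have "((\<lambda>x. exp (- (M * x)) * (a + integral {0..x} ?h)) has_real_derivative
      exp (- (M * t)) * ?h t + - (exp (- (M * t)) * M) * (a + integral {0..t} ?h)) (at t within {0..})"
    by (auto intro!: derivative_eq_intros)
  moreover have "exp (- (M * t)) * ?h t + - (exp (- (M * t)) * M) * (a + integral {0..t} ?h)
      = M * (g t - exp (- (M * t)) * (a + integral {0..t} ?h))"
    by (simp add: exp_minus right_diff_distrib)
  ultimately show ?thesis
    unfolding duhamel_def by (simp only:)
qed

lemma duhamel_diff_le:
  assumes M: "0 \<le> M" and t: "0 \<le> t" and g: "continuous_on {0..} g" and h: "continuous_on {0..} h"
    and q: "continuous_on {0..t} q"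
    and le: "\<And>s. 0 \<le> s \<Longrightarrow> s \<le> t \<Longrightarrow> \<bar>g s - h s\<bar> \<le> q s"
  shows "\<bar>duhamel M a g t - duhamel M a h t\<bar> \<le> integral {0..t} (\<lambda>s. M * q s)"
proof -
  have int: "(\<lambda>s. M * exp (M * s) * f s) integrable_on {0..t}" if "continuous_on {0..} f" for f
    by (intro integrable_continuous_real continuous_duhamel_integrand that)
  have "duhamel M a g t - duhamel M a h t
     = exp (- (M * t)) * integral {0..t} (\<lambda>s. M * exp (M * s) * g s - M * exp (M * s) * h s)"
    unfolding duhamel_def
    by (subst Henstock_Kurzweil_Integration.integral_diff[OF int[OF g] int[OF h]]) (simp add: algebra_simps)
  also have "\<dots> = integral {0..t} (\<lambda>s. exp (- (M * t)) * (M * exp (M * s) * g s - M * exp (M * s) * h s))"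
    by (rule integral_mult_right[symmetric])
  finally have eq: "duhamel M a g t - duhamel M a h t = \<dots>" .
  show ?thesis
    unfolding eq real_norm_def[symmetric]
  proof (rule integral_norm_bound_integral)
    show "(\<lambda>s. exp (- (M * t)) * (M * exp (M * s) * g s - M * exp (M * s) * h s)) integrable_on {0..t}"
      by (intro integrable_on_mult_right integrable_diff int g h)
    show "(\<lambda>s. M * q s) integrable_on {0..t}"
      by (intro integrable_continuous_real continuous_intros q)
    fix s assume s: "s \<in> {0..t}"
    have "exp (- (M * t)) * (M * exp (M * s) * g s - M * exp (M * s) * h s)
        = M * (exp (M * s - M * t) * (g s - h s))"
      by (simp add: exp_diff exp_minus field_simps)
    then have "norm (exp (- (M * t)) * (M * exp (M * s) * g s - M * exp (M * s) * h s))
      = M * (exp (M * s - M * t) * \<bar>g s - h s\<bar>)"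
      using M by (simp only: real_norm_def abs_mult abs_exp_cancel abs_of_nonneg)
    also have "\<dots> \<le> M * (1 * q s)"
      using M s le[of s] by (intro mult_left_mono[OF _ M] mult_mono) (auto intro: mult_left_mono)
    finally show "norm (exp (- (M * t)) * (M * exp (M * s) * g s - M * exp (M * s) * h s)) \<le> M * q s" by simp
  qed
qed

lemma duhamel_in_unit:
  assumes M: "0 \<le> M" and t: "0 \<le> t" and a: "a \<in> {0..1}" and g: "continuous_on {0..} g"
    and unit: "\<And>s. 0 \<le> s \<Longrightarrow> g s \<in> {0..1}"
  shows "duhamel M a g t \<in> {0..1}"
proof -
  have "((\<lambda>s. M * exp (M * s)) has_integral (exp (M * t) - exp (M * 0))) {0..t}"
    using t by (intro fundamental_theorem_of_calculus)
      (auto intro!: derivative_eq_intros simp flip: has_real_derivative_iff_has_vector_derivative)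
  then have E: "((\<lambda>s. M * exp (M * s)) has_integral (exp (M * t) - 1)) {0..t}" by simp
  have I: "((\<lambda>s. M * exp (M * s) * g s) has_integral integral {0..t} (\<lambda>s. M * exp (M * s) * g s)) {0..t}"
    by (intro integrable_integral integrable_continuous_real continuous_duhamel_integrand g)
  have "0 \<le> integral {0..t} (\<lambda>s. M * exp (M * s) * g s)"
    by (rule has_integral_nonneg[OF I]) (use M unit in auto)
  moreover have "integral {0..t} (\<lambda>s. M * exp (M * s) * g s) \<le> exp (M * t) - 1"
  proof (rule has_integral_le[OF I E])
    fix s assume "s \<in> {0..t}"
    with unit[of s] have "g s \<le> 1" by simp
    then show "M * exp (M * s) * g s \<le> M * exp (M * s)" using M by (intro mult_left_le) auto
  qed
  ultimately have *: "0 \<le> a + integral {0..t} (\<lambda>s. M * exp (M * s) * g s)"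
    "a + integral {0..t} (\<lambda>s. M * exp (M * s) * g s) \<le> exp (M * t)"
    using a by auto
  have "duhamel M a g t \<le> exp (- (M * t)) * exp (M * t)"
    unfolding duhamel_def by (intro mult_left_mono *) auto
  also have "\<dots> = 1" by (simp flip: exp_add)
  finally show ?thesis using * by (simp add: duhamel_def)
qed

lemma summable_increments_limit:
  fixes d c :: "nat \<Rightarrow> real"
  assumes le: "\<And>n. \<bar>d (Suc n) - d n\<bar> \<le> c n" and c: "summable c"
  shows "\<exists>l. d \<longlonglongrightarrow> l \<and> (\<forall>n. \<bar>l - d n\<bar> \<le> (\<Sum>k. c (k + n)))"
proof -
  have "summable (\<lambda>n. d (Suc n) - d n)"
    by (rule summable_comparison_test'[OF c, of 0]) (use le in simp)
  then have "(\<lambda>n. d 0 + (\<Sum>k<n. d (Suc k) - d k)) \<longlonglongrightarrow> d 0 + (\<Sum>k. d (Suc k) - d k)"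
    by (intro tendsto_add tendsto_const summable_LIMSEQ)
  then obtain l where l: "d \<longlonglongrightarrow> l" by (auto simp: sum_lessThan_telescope)
  moreover have "\<bar>l - d n\<bar> \<le> (\<Sum>k. c (k + n))" for n
  proof -
    have cn: "summable (\<lambda>k. c (k + n))" using c by (simp add: summable_iff_shift)
    have sums: "(\<lambda>k. d (Suc k + n) - d (k + n)) sums (l - d (0 + n))"
      using telescope_sums[OF LIMSEQ_ignore_initial_segment[OF l, of n]] by simp
    have "norm (\<Sum>k. d (Suc k + n) - d (k + n)) \<le> (\<Sum>k. c (k + n))"
      by (rule norm_suminf_le[OF _ cn]) (use le in simp)
    then show ?thesis using sums_unique[OF sums] by simp
  qed
  ultimately show ?thesis by blast
qed

text \<open>Picard iteration for Duhamel's formula. It expresses the value at time \<open>t\<close> as a convex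
  combination of points of the cube, which gives existence and invariance of the cube at once.\<close>

lemma cube_flow_exists:
  fixes G :: "('i \<Rightarrow> real) \<Rightarrow> 'i \<Rightarrow> real"
  assumes M: "0 \<le> M" and C: "0 \<le> C"
    and G_unit: "\<And>u i. (\<And>j. u j \<in> {0..1}) \<Longrightarrow> G u i \<in> {0..1}"
    and G_lipschitz: "\<And>u w i r. (\<And>j. u j \<in> {0..1}) \<Longrightarrow> (\<And>j. w j \<in> {0..1}) \<Longrightarrow>
       (\<And>j. \<bar>u j - w j\<bar> \<le> r) \<Longrightarrow> \<bar>G u i - G w i\<bar> \<le> C * r"
    and a: "\<And>i. a i \<in> {0..1}"
  shows "\<exists>\<phi>. \<phi> 0 = a \<and> (\<forall>t\<ge>0. \<forall>i. \<phi> t i \<in> {0..1} \<and>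
     ((\<lambda>s. \<phi> s i) has_real_derivative M * (G (\<phi> t) i - \<phi> t i)) (at t within {0..}))"
proof -
  define good :: "(real \<Rightarrow> 'i \<Rightarrow> real) \<Rightarrow> bool" where
    "good \<psi> \<longleftrightarrow> (\<forall>t\<ge>0. \<forall>i. \<psi> t i \<in> {0..1}) \<and> (\<forall>t\<ge>0. \<forall>s\<ge>0. \<forall>i. \<bar>\<psi> t i - \<psi> s i\<bar> \<le> M * \<bar>t - s\<bar>)" for \<psi>
  have good_unit: "\<psi> t i \<in> {0..1}" if "good \<psi>" "0 \<le> t" for \<psi> t i
    using that unfolding good_def by blast
  have cont_G: "continuous_on {0..} (\<lambda>s. G (\<psi> s) i)" if \<psi>: "good \<psi>" for \<psi> i
  proof -
    have "dist (G (\<psi> t) i) (G (\<psi> s) i) \<le> (C * M) * dist t s" if "t \<ge> 0" "s \<ge> 0" for t s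
      using G_lipschitz[of "\<psi> t" "\<psi> s" "M * \<bar>t - s\<bar>" i] \<psi> that
      unfolding good_def by (auto simp: dist_real_def mult.assoc)
    then have "(C * M)-lipschitz_on {0..} (\<lambda>s. G (\<psi> s) i)"
      using M C by (intro lipschitz_onI) auto
    then show ?thesis by (rule lipschitz_on_continuous_on)
  qed
  define step where "step \<psi> t i = duhamel M (a i) (\<lambda>s. G (\<psi> s) i) t" for \<psi> t i
  have good_step: "good (step \<psi>)" if \<psi>: "good \<psi>" for \<psi>
  proof -
    have unit: "step \<psi> t i \<in> {0..1}" if "0 \<le> t" for t i
      unfolding step_def using M that a cont_G[OF \<psi>] G_unit good_unit[OF \<psi>]
      by (intro duhamel_in_unit) auto
    moreover have "\<bar>step \<psi> t i - step \<psi> s i\<bar> \<le> M * \<bar>t - s\<bar>" if "t \<ge> 0" "s \<ge> 0" for t s i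
    proof -
      have "norm (step \<psi> t i - step \<psi> s i) \<le> M * norm (t - s)"
      proof (rule field_differentiable_bound[of "{0..}"])
        fix r :: real assume "r \<in> {0..}"
        then have r: "0 \<le> r" by simp
        show "((\<lambda>t. step \<psi> t i) has_real_derivative M * (G (\<psi> r) i - step \<psi> r i)) (at r within {0..})"
          unfolding step_def by (rule duhamel_deriv[OF cont_G[OF \<psi>] r])
        have "G (\<psi> r) i \<in> {0..1}" using G_unit good_unit[OF \<psi> r] by blast
        then have "\<bar>G (\<psi> r) i - step \<psi> r i\<bar> \<le> 1" using unit[OF r, of i] by auto
        then show "norm (M * (G (\<psi> r) i - step \<psi> r i)) \<le> M"
          using M by (simp add: abs_mult mult_left_le)
      qed (use that in auto)
      then show ?thesis by simp
    qed
    ultimately show ?thesis unfolding good_def by blast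
  qed
  define P where "P n = (step ^^ n) (\<lambda>t. a)" for n
  have P_Suc: "P (Suc n) = step (P n)" for n by (simp add: P_def)
  have good_P: "good (P n)" for n
  proof (induction n)
    case 0
    show ?case using a M by (auto simp: P_def good_def)
  next
    case (Suc n)
    then show ?case by (simp add: P_Suc good_step)
  qed
  define c where "c t n = (M * C * t) ^ n / fact n" for t n
  have P_diff: "\<bar>P (Suc n) t i - P n t i\<bar> \<le> c t n" if "0 \<le> t" for n t i
    using that
  proof (induction n arbitrary: t i)
    case 0
    then show ?case
      using good_unit[OF good_P, of t 1 i] good_unit[OF good_P, of t 0 i] by (auto simp: c_def)
  next
    case (Suc n)
    have "\<bar>P (Suc (Suc n)) t i - P (Suc n) t i\<bar> \<le> integral {0..t} (\<lambda>s. M * (C * c s n))"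
      unfolding P_Suc[of "Suc n"] P_Suc[of n] step_def[of "step (P n)"] step_def[of "P n" t]
      unfolding P_Suc[of n, symmetric]
    proof (rule duhamel_diff_le[OF M Suc.prems])
      show "continuous_on {0..} (\<lambda>s. G (P (Suc n) s) i)" "continuous_on {0..} (\<lambda>s. G (P n s) i)"
        by (rule cont_G[OF good_P])+
      show "continuous_on {0..t} (\<lambda>s. C * c s n)"
        unfolding c_def by (intro continuous_intros) auto
      fix s :: real assume s: "0 \<le> s"
      show "\<bar>G (P (Suc n) s) i - G (P n s) i\<bar> \<le> C * c s n"
        by (rule G_lipschitz[OF good_unit[OF good_P s] good_unit[OF good_P s] Suc.IH[OF s]])
    qed
    also have "((\<lambda>s. M * (C * c s n)) has_integral c t (Suc n) - c 0 (Suc n)) {0..t}"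
    proof (rule fundamental_theorem_of_calculus[OF Suc.prems])
      fix s assume "s \<in> {0..t}"
      have "((\<lambda>s. c s (Suc n)) has_real_derivative real (Suc n) * (M * C * s) ^ n * (M * C) / fact (Suc n)) (at s within {0..t})"
        unfolding c_def by (rule derivative_eq_intros refl | simp)+
      also have "real (Suc n) * (M * C * s) ^ n * (M * C) / fact (Suc n) = M * (C * c s n)"
        by (simp add: c_def field_simps del: of_nat_Suc)
      finally show "((\<lambda>s. c s (Suc n)) has_vector_derivative M * (C * c s n)) (at s within {0..t})"
        by (simp add: has_real_derivative_iff_has_vector_derivative)
    qed
    then have "integral {0..t} (\<lambda>s. M * (C * c s n)) = c t (Suc n) - c 0 (Suc n)"
      by (rule integral_unique)
    also have "c 0 (Suc n) = 0" by (simp add: c_def)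
    finally show ?case by simp
  qed
  have c_summable: "summable (c t)" for t
  proof -
    have "c t = (\<lambda>n. inverse (fact n) * (M * C * t) ^ n)"
      by (rule ext) (simp only: c_def divide_inverse mult.commute)
    then show ?thesis using summable_exp[of "M * C * t"] by simp
  qed
  define \<rho> where "\<rho> t n = (\<Sum>k. c t (k + n))" for t n
  have \<rho>_lim: "\<rho> t \<longlonglongrightarrow> 0" for t
    unfolding \<rho>_def by (rule suminf_exist_split2[OF c_summable])
  have "\<exists>l. (\<lambda>n. P n t i) \<longlonglongrightarrow> l \<and> (\<forall>n. \<bar>l - P n t i\<bar> \<le> \<rho> t n)" if "0 \<le> t" for t i
    unfolding \<rho>_def using P_diff[OF that] by (intro summable_increments_limit c_summable)
  then have "\<forall>t i. \<exists>l. 0 \<le> t \<longrightarrow> (\<lambda>n. P n t i) \<longlonglongrightarrow> l \<and> (\<forall>n. \<bar>l - P n t i\<bar> \<le> \<rho> t n)" by blast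
  then obtain \<phi> where \<phi>: "\<And>t i. 0 \<le> t \<Longrightarrow> (\<lambda>n. P n t i) \<longlonglongrightarrow> \<phi> t i"
      "\<And>t i n. 0 \<le> t \<Longrightarrow> \<bar>\<phi> t i - P n t i\<bar> \<le> \<rho> t n"
    unfolding choice_iff by blast
  have good_\<phi>: "good \<phi>"
    unfolding good_def
  proof (intro conjI allI impI)
    fix t i assume t: "0 \<le> (t::real)"
    show "\<phi> t i \<in> {0..1}"
      using LIMSEQ_le_const[OF \<phi>(1)[OF t]] LIMSEQ_le_const2[OF \<phi>(1)[OF t]] good_unit[OF good_P t]
      by (simp only: atLeastAtMost_iff) blast
    fix s assume s: "0 \<le> (s::real)"
    have "(\<lambda>n. \<bar>P n t i - P n s i\<bar>) \<longlonglongrightarrow> \<bar>\<phi> t i - \<phi> s i\<bar>"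
      by (intro tendsto_intros \<phi> s t)
    then show "\<bar>\<phi> t i - \<phi> s i\<bar> \<le> M * \<bar>t - s\<bar>"
      by (rule LIMSEQ_le_const2) (use good_P s t in \<open>auto simp: good_def\<close>)
  qed
  have fixed: "\<phi> t i = step \<phi> t i" if t: "0 \<le> t" for t i
  proof (rule LIMSEQ_unique[OF LIMSEQ_Suc[OF \<phi>(1)[OF t]]])
    have "(\<lambda>n. integral {0..t} (\<lambda>s. M * exp (M * s) * G (P n s) i))
        \<longlonglongrightarrow> integral {0..t} (\<lambda>s. M * exp (M * s) * G (\<phi> s) i)"
    proof (rule dominated_convergence(2))
      show "(\<lambda>s. M * exp (M * s) * G (P n s) i) integrable_on {0..t}" for n
        by (intro integrable_continuous_real continuous_duhamel_integrand cont_G good_P)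
      show "(\<lambda>s. M * exp (M * s)) integrable_on {0..t}"
        by (intro integrable_continuous_real continuous_intros)
      fix s assume "s \<in> {0..t}"
      then have s: "0 \<le> s" by simp
      have "G (P n s) i \<in> {0..1}" for n using G_unit good_unit[OF good_P s] by blast
      then show "norm (M * exp (M * s) * G (P n s) i) \<le> M * exp (M * s)" for n
        using M by (simp add: abs_mult mult_left_le)
      have "(\<lambda>n. G (P n s) i) \<longlonglongrightarrow> G (\<phi> s) i"
      proof (rule LIM_zero_cancel, rule Lim_null_comparison)
        show "\<forall>\<^sub>F n in sequentially. norm (G (P n s) i - G (\<phi> s) i) \<le> C * \<rho> s n"
          using G_lipschitz[OF good_unit[OF good_P s] good_unit[OF good_\<phi> s]] \<phi>(2)[OF s]
          by (intro always_eventually allI) (simp add: abs_minus_commute)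
        show "(\<lambda>n. C * \<rho> s n) \<longlonglongrightarrow> 0"
          using tendsto_mult[OF tendsto_const[of C] \<rho>_lim[of s]] by simp
      qed
      then show "(\<lambda>n. M * exp (M * s) * G (P n s) i) \<longlonglongrightarrow> M * exp (M * s) * G (\<phi> s) i"
        by (intro tendsto_mult tendsto_const)
    qed
    then show "(\<lambda>n. P (Suc n) t i) \<longlonglongrightarrow> step \<phi> t i"
      unfolding P_Suc step_def duhamel_def by (intro tendsto_mult tendsto_add tendsto_const)
  qed
  have "((\<lambda>s. \<phi> s i) has_real_derivative M * (G (\<phi> t) i - \<phi> t i)) (at t within {0..})" if t: "0 \<le> t" for t i
  proof -
    have "((\<lambda>s. step \<phi> s i) has_real_derivative M * (G (\<phi> t) i - step \<phi> t i)) (at t within {0..})"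
      unfolding step_def by (rule duhamel_deriv[OF cont_G[OF good_\<phi>] t])
    then have "((\<lambda>s. step \<phi> s i) has_real_derivative M * (G (\<phi> t) i - \<phi> t i)) (at t within {0..})"
      by (simp only: fixed[OF t, symmetric])
    then show ?thesis
      by (rule has_field_derivative_transform_within[OF _ zero_less_one]) (use t fixed in auto)
  qed
  moreover have "\<phi> 0 = a" using fixed[of 0] by (auto simp: step_def)
  ultimately show ?thesis using good_unit[OF good_\<phi>] by blast
qed

subsection \<open>Twist potentials\<close>

lemma C1_D1: "C1 f \<Longrightarrow> ((\<lambda>s. f s y) has_real_derivative D1 f x y) (at x)"
  by (simp add: C1_def D1_def DERIV_deriv_iff_real_differentiable)

lemma C1_D2: "C1 f \<Longrightarrow> ((\<lambda>s. f x s) has_real_derivative D2 f x y) (at y)"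
  by (simp add: C1_def D2_def DERIV_deriv_iff_real_differentiable)

lemma C1_has_derivative:
  assumes "C1 f"
  shows "((\<lambda>(x, y). f x y) has_derivative (\<lambda>(h, k). D1 f x y * h + D2 f x y * k)) (at (x, y))"
proof -
  have D2_cont: "continuous_on UNIV (\<lambda>(x, y). D2 f x y)"
    using assms by (simp add: C1_def)
  have "((\<lambda>(x, y). f x y) has_derivative (\<lambda>(h, k). D1 f x y * h + blinfun_mult_right (D2 f x y) k))
      (at (x, y) within UNIV \<times> UNIV)"
  proof (rule has_derivative_partialsI)
    show "((\<lambda>x. f x y) has_derivative (*) (D1 f x y)) (at x within UNIV)"
      using C1_D1[OF assms] by (simp add: has_field_derivative_def)
    show "((\<lambda>y. f x y) has_derivative blinfun_apply (blinfun_mult_right (D2 f x y))) (at y within UNIV)" for x y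
      using C1_D2[OF assms] by (simp add: has_field_derivative_def)
    have "continuous_on UNIV (\<lambda>z. blinfun_mult_right (case z of (x, y) \<Rightarrow> D2 f x y))"
      by (intro bounded_linear.continuous_on[OF bounded_linear_blinfun_mult_right] D2_cont)
    then show "continuous (at (x, y) within UNIV \<times> UNIV) (\<lambda>(x, y). blinfun_mult_right (D2 f x y))"
      by (simp add: continuous_on_eq_continuous_at case_prod_unfold)
  qed auto
  then show ?thesis by simp
qed

lemma C1_continuous: "C1 f \<Longrightarrow> continuous_on UNIV (\<lambda>(x, y). f x y)"
  using C1_has_derivative has_derivative_continuous
  by (metis (no_types, lifting) continuous_at_imp_continuous_on surj_pair)

lemma C1_chain:
  assumes f: "C1 f" and p: "(p has_real_derivative p') (at t within S)"
    and q: "(q has_real_derivative q') (at t within S)"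
  shows "((\<lambda>s. f (p s) (q s)) has_real_derivative D1 f (p t) (q t) * p' + D2 f (p t) (q t) * q') (at t within S)"
proof -
  have "((\<lambda>s. (p s, q s)) has_derivative (\<lambda>h. (p' * h, q' * h))) (at t within S)"
    using p q by (auto simp: has_field_derivative_def intro: has_derivative_Pair)
  from has_derivative_compose[OF this C1_has_derivative[OF f]]
  have "((\<lambda>s. f (p s) (q s)) has_derivative (\<lambda>h. D1 f (p t) (q t) * (p' * h) + D2 f (p t) (q t) * (q' * h))) (at t within S)"
    by simp
  also have "(\<lambda>h. D1 f (p t) (q t) * (p' * h) + D2 f (p t) (q t) * (q' * h))
      = (*) (D1 f (p t) (q t) * p' + D2 f (p t) (q t) * q')"
    by (simp add: fun_eq_iff algebra_simps)
  finally show ?thesis by (simp only: has_field_derivative_def)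
qed

lemma continuous_on_compose_pair:
  assumes "continuous_on UNIV (\<lambda>(x, y). f x y)" "continuous_on S p" "continuous_on S q"
  shows "continuous_on S (\<lambda>w. f (p w) (q w))"
  using continuous_on_compose2[OF assms(1) continuous_on_Pair[OF assms(2,3)] subset_UNIV] by simp

lemma C1_compose_continuous:
  "C1 f \<Longrightarrow> continuous_on S p \<Longrightarrow> continuous_on S q \<Longrightarrow> continuous_on S (\<lambda>w. f (p w) (q w))"
  by (rule continuous_on_compose_pair[OF C1_continuous])

lemma C1_lipschitz:
  assumes f: "C1 f"
  obtains C where "0 \<le> C" "\<And>x y x' y'. x \<in> {0..1} \<Longrightarrow> y \<in> {0..1} \<Longrightarrow> x' \<in> {0..1} \<Longrightarrow> y' \<in> {0..1} \<Longrightarrow>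
    \<bar>f x y - f x' y'\<bar> \<le> C * (\<bar>x - x'\<bar> + \<bar>y - y'\<bar>)"
proof -
  have bnd: "\<exists>C. \<forall>x\<in>{0..1}. \<forall>y\<in>{0..1}. \<bar>g x y\<bar> \<le> C" if "continuous_on UNIV (\<lambda>(x, y). g x y)"
    for g :: "real \<Rightarrow> real \<Rightarrow> real"
  proof -
    have "bounded ((\<lambda>(x, y). g x y) ` ({0..1} \<times> {0..1}))"
      by (intro compact_imp_bounded compact_continuous_image compact_Times continuous_on_subset[OF that]) auto
    then obtain C where "\<forall>z\<in>(\<lambda>(x, y). g x y) ` ({0..1} \<times> {0..1}). norm z \<le> C"
      by (auto simp: bounded_iff)
    then show ?thesis by (intro exI[of _ C]) force
  qed
  have cont: "continuous_on UNIV (\<lambda>(x, y). D1 f x y)" "continuous_on UNIV (\<lambda>(x, y). D2 f x y)"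
    using f by (simp_all add: C1_def)
  obtain M1 M2 where M1: "\<And>x y. x \<in> {0..1} \<Longrightarrow> y \<in> {0..1} \<Longrightarrow> \<bar>D1 f x y\<bar> \<le> M1"
    and M2: "\<And>x y. x \<in> {0..1} \<Longrightarrow> y \<in> {0..1} \<Longrightarrow> \<bar>D2 f x y\<bar> \<le> M2"
    using bnd[OF cont(1)] bnd[OF cont(2)] by blast
  define C where "C = max 0 (max M1 M2)"
  show ?thesis
  proof (rule that[of C])
    fix x y x' y' :: real assume xy: "x \<in> {0..1}" "y \<in> {0..1}" "x' \<in> {0..1}" "y' \<in> {0..1}"
    have "norm (f x y - f x' y) \<le> C * norm (x - x')"
      by (rule field_differentiable_bound[of "{0..1}" "\<lambda>s. f s y" "\<lambda>s. D1 f s y"])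
         (use xy M1 in \<open>auto simp: C_def le_max_iff_disj intro: has_field_derivative_at_within C1_D1[OF f]\<close>)
    moreover have "norm (f x' y - f x' y') \<le> C * norm (y - y')"
      by (rule field_differentiable_bound[of "{0..1}" "\<lambda>s. f x' s" "\<lambda>s. D2 f x' s"])
         (use xy M2 in \<open>auto simp: C_def le_max_iff_disj intro: has_field_derivative_at_within C1_D2[OF f]\<close>)
    ultimately show "\<bar>f x y - f x' y'\<bar> \<le> C * (\<bar>x - x'\<bar> + \<bar>y - y'\<bar>)"
      by (simp add: algebra_simps)
  qed (simp add: C_def)
qed

locale twist_potential =
  fixes L :: "real \<Rightarrow> real \<Rightarrow> real"
  assumes smooth: "C2 L"
    and periodic: "\<And>x y (k::int). L x y = L (x + of_int k) (y + of_int k)"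
    and strict_min: "\<And>x y. \<not> (\<exists>k::int. x = of_int k \<and> y = of_int k) \<Longrightarrow> L 0 0 < L x y"
    and twist: "\<And>x y. D2 (D1 L) x y \<le> 0"
    and even: "\<And>x y. L x y = L (- x) (- y)"
begin

lemma C1_L: "C1 L" and C1_D1L: "C1 (D1 L)" and C1_D2L: "C1 (D2 L)"
  using smooth by (auto simp: C2_def)

lemma minimum: "L 0 0 \<le> L x y"
proof (cases "\<exists>k::int. x = of_int k \<and> y = of_int k")
  case True
  then show ?thesis using periodic[of 0 0] by auto
qed (use strict_min in \<open>auto intro: less_imp_le\<close>)

lemma D_zero: "D1 L 0 0 = 0" "D2 L 0 0 = 0"
  using DERIV_local_min[OF C1_D1[OF C1_L], of 1] DERIV_local_min[OF C1_D2[OF C1_L], of 1] minimum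
  by auto

lemma D_periodic: "D1 L (x + 1) (y + 1) = D1 L x y" "D2 L (x + 1) (y + 1) = D2 L x y"
proof -
  have per: "L (x + 1) (y + 1) = L x y" for x y using periodic[of x y 1] by simp
  have "((\<lambda>s. L (s + 1) (y + 1)) has_real_derivative D1 L (x + 1) (y + 1)) (at x)"
    using C1_D1[OF C1_L, of "y + 1" "x + 1"] by (simp add: DERIV_shift)
  then show "D1 L (x + 1) (y + 1) = D1 L x y"
    unfolding per by (rule DERIV_unique[OF _ C1_D1[OF C1_L]])
  have "((\<lambda>s. L (x + 1) (s + 1)) has_real_derivative D2 L (x + 1) (y + 1)) (at y)"
    using C1_D2[OF C1_L, of "x + 1" "y + 1"] by (simp add: DERIV_shift)
  then show "D2 L (x + 1) (y + 1) = D2 L x y"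
    unfolding per by (rule DERIV_unique[OF _ C1_D2[OF C1_L]])
qed

lemma D_one: "D1 L 1 1 = 0" "D2 L 1 1 = 0"
  using D_periodic[of 0 0] D_zero by auto

lemma D_reflect: "D1 L (1 - x) (1 - y) = - D1 L x y" "D2 L (1 - x) (1 - y) = - D2 L x y"
proof -
  have refl: "L (1 - x) (1 - y) = L x y" for x y
    using periodic[of "- x" "- y" 1] even[of x y] by simp
  have "((\<lambda>s. L (1 - s) (1 - y)) has_real_derivative D1 L (1 - x) (1 - y) * (- 1)) (at x)"
    by (rule DERIV_chain2[OF C1_D1[OF C1_L]]) (auto intro!: derivative_eq_intros)
  then show "D1 L (1 - x) (1 - y) = - D1 L x y"
    unfolding refl using DERIV_unique[OF _ C1_D1[OF C1_L]] by fastforce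
  have "((\<lambda>s. L (1 - x) (1 - s)) has_real_derivative D2 L (1 - x) (1 - y) * (- 1)) (at y)"
    by (rule DERIV_chain2[OF C1_D2[OF C1_L]]) (auto intro!: derivative_eq_intros)
  then show "D2 L (1 - x) (1 - y) = - D2 L x y"
    unfolding refl using DERIV_unique[OF _ C1_D2[OF C1_L]] by fastforce
qed

lemma D1_antimono: "y \<le> y' \<Longrightarrow> D1 L x y' \<le> D1 L x y"
  by (rule DERIV_nonpos_imp_nonincreasing[of y y' "D1 L x"]) (use twist C1_D2[OF C1_D1L] in blast)+

text \<open>Integrating \<open>L\<^sub>1\<^sub>2 \<le> 0\<close> twice shows that mixed differences of \<open>L\<close> are nonpositive; this
  avoids the symmetry of second derivatives.\<close>

lemma D2_antimono: "x \<le> x' \<Longrightarrow> D2 L x' y \<le> D2 L x y"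
proof -
  assume x: "x \<le> x'"
  have "mono_on UNIV (\<lambda>s. L x s - L x' s)"
  proof (rule mono_onI)
    fix r s :: real assume rs: "r \<le> s"
    have "L x' s - L x' r \<le> L x s - L x r"
    proof (rule DERIV_nonpos_imp_nonincreasing[OF x, of "\<lambda>z. L z s - L z r"])
      fix z
      have "((\<lambda>z. L z s - L z r) has_real_derivative D1 L z s - D1 L z r) (at z)"
        by (intro DERIV_diff C1_D1[OF C1_L])
      moreover have "D1 L z s - D1 L z r \<le> 0" using D1_antimono[OF rs] by simp
      ultimately show "\<exists>d. ((\<lambda>z. L z s - L z r) has_real_derivative d) (at z) \<and> d \<le> 0" by blast
    qed
    then show "L x r - L x' r \<le> L x s - L x' s" by simp
  qed
  moreover have "((\<lambda>s. L x s - L x' s) has_real_derivative D2 L x y - D2 L x' y) (at y)"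
    by (intro DERIV_diff C1_D2[OF C1_L])
  ultimately have "0 \<le> D2 L x y - D2 L x' y"
    by (rule mono_on_imp_deriv_nonneg) auto
  then show ?thesis by simp
qed

lemma curvature_bound_ge:
  assumes "x \<in> {0..1}" "y \<in> {0..1}" "z \<in> {0..1}"
  shows "D2 (D2 L) x y + D1 (D1 L) y z \<le> curvature_bound L"
proof -
  have cont: "continuous_on UNIV (\<lambda>(x, y). D2 (D2 L) x y)" "continuous_on UNIV (\<lambda>(x, y). D1 (D1 L) x y)"
    using C1_D1L C1_D2L by (auto simp: C1_def)
  have "continuous_on ({0..1} \<times> {0..1} \<times> {0..1}) (\<lambda>(x, y, z). D2 (D2 L) x y + D1 (D1 L) y z)"
    unfolding case_prod_unfold
    by (intro continuous_on_add continuous_on_compose_pair[OF cont(1)] continuous_on_compose_pair[OF cont(2)]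
        continuous_on_fst continuous_on_snd continuous_on_id)
  then have "compact ((\<lambda>(x, y, z). D2 (D2 L) x y + D1 (D1 L) y z) ` ({0..1} \<times> {0..1} \<times> {0..1}))"
    by (intro compact_continuous_image compact_Times compact_Icc)
  then have "bdd_above ((\<lambda>(x, y, z). D2 (D2 L) x y + D1 (D1 L) y z) ` ({0..1} \<times> {0..1} \<times> {0..1}))"
    by (intro bounded_imp_bdd_above compact_imp_bounded)
  then show ?thesis
    unfolding curvature_bound_def
    using cSUP_upper[of "(x, y, z)" "{0..1} \<times> {0..1} \<times> {0..1}" "\<lambda>(x, y, z). D2 (D2 L) x y + D1 (D1 L) y z"] assms
    by simp
qed

lemma diagonal_force_bounds:
  assumes a: "a \<in> {0..1}"
  shows "D2 L 0 a + D1 L a 0 \<le> curvature_bound L * a"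
    and "- (D2 L 1 a + D1 L a 1) \<le> curvature_bound L * (1 - a)"
proof -
  have deriv: "((\<lambda>s. curvature_bound L * s - (D2 L c s + D1 L s c)) has_real_derivative
      curvature_bound L - (D2 (D2 L) c s + D1 (D1 L) s c)) (at s)" for c s
    by (auto intro!: derivative_eq_intros C1_D2[OF C1_D2L] C1_D1[OF C1_D1L])
  have mono: "curvature_bound L * s - (D2 L c s + D1 L s c) \<le> curvature_bound L * t - (D2 L c t + D1 L t c)"
    if "c \<in> {0..1}" "0 \<le> s" "s \<le> t" "t \<le> 1" for c s t
  proof (rule DERIV_nonneg_imp_nondecreasing[OF \<open>s \<le> t\<close>, of "\<lambda>s. curvature_bound L * s - (D2 L c s + D1 L s c)"])
    fix r assume "s \<le> r" "r \<le> t"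
    then have "D2 (D2 L) c r + D1 (D1 L) r c \<le> curvature_bound L"
      using that by (intro curvature_bound_ge) auto
    then have "0 \<le> curvature_bound L - (D2 (D2 L) c r + D1 (D1 L) r c)" by simp
    with deriv[of c r] show "\<exists>d. ((\<lambda>s. curvature_bound L * s - (D2 L c s + D1 L s c)) has_real_derivative d) (at r) \<and> 0 \<le> d"
      by blast
  qed
  show "D2 L 0 a + D1 L a 0 \<le> curvature_bound L * a"
    using mono[of 0 0 a] a by (simp add: D_zero)
  show "- (D2 L 1 a + D1 L a 1) \<le> curvature_bound L * (1 - a)"
    using mono[of 1 a 1] a by (simp add: D_one algebra_simps)
qed

lemma force_bounds:
  fixes u :: "int ^ 'n::finite \<Rightarrow> real"
  assumes u: "\<And>\<alpha>. u \<alpha> \<in> {0..1}"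
  shows "- (real CARD('n) * curvature_bound L * u \<alpha>) \<le> force L u \<alpha>"
    and "force L u \<alpha> \<le> real CARD('n) * curvature_bound L * (1 - u \<alpha>)"
proof -
  have "(\<Sum>j\<in>UNIV. D2 L (u (\<alpha> - axis j 1)) (u \<alpha>) + D1 L (u \<alpha>) (u (\<alpha> + axis j 1)))
      \<le> (\<Sum>j\<in>(UNIV :: 'n set). curvature_bound L * u \<alpha>)"
  proof (rule sum_mono)
    fix j
    have "D2 L (u (\<alpha> - axis j 1)) (u \<alpha>) \<le> D2 L 0 (u \<alpha>)" "D1 L (u \<alpha>) (u (\<alpha> + axis j 1)) \<le> D1 L (u \<alpha>) 0"
      using u by (auto intro!: D2_antimono D1_antimono)
    then show "D2 L (u (\<alpha> - axis j 1)) (u \<alpha>) + D1 L (u \<alpha>) (u (\<alpha> + axis j 1)) \<le> curvature_bound L * u \<alpha>"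
      using diagonal_force_bounds(1)[OF u[of \<alpha>]] by linarith
  qed
  then show "- (real CARD('n) * curvature_bound L * u \<alpha>) \<le> force L u \<alpha>"
    by (simp add: force_def)
  have "(\<Sum>j\<in>UNIV. - (D2 L (u (\<alpha> - axis j 1)) (u \<alpha>) + D1 L (u \<alpha>) (u (\<alpha> + axis j 1))))
      \<le> (\<Sum>j\<in>(UNIV :: 'n set). curvature_bound L * (1 - u \<alpha>))"
  proof (rule sum_mono)
    fix j
    have "D2 L (u (\<alpha> - axis j 1)) (u \<alpha>) \<ge> D2 L 1 (u \<alpha>)" "D1 L (u \<alpha>) (u (\<alpha> + axis j 1)) \<ge> D1 L (u \<alpha>) 1"
      using u by (auto intro!: D2_antimono D1_antimono)
    then show "- (D2 L (u (\<alpha> - axis j 1)) (u \<alpha>) + D1 L (u \<alpha>) (u (\<alpha> + axis j 1))) \<le> curvature_bound L * (1 - u \<alpha>)"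
      using diagonal_force_bounds(2)[OF u[of \<alpha>]] by linarith
  qed
  then show "force L u \<alpha> \<le> real CARD('n) * curvature_bound L * (1 - u \<alpha>)"
    unfolding force_def sum_negf[symmetric] by (simp add: mult.assoc)
qed

lemma force_lipschitz:
  obtains C where "0 \<le> C" "\<And>(u :: int ^ 'n::finite \<Rightarrow> real) w \<alpha> r. (\<And>\<beta>. u \<beta> \<in> {0..1}) \<Longrightarrow> (\<And>\<beta>. w \<beta> \<in> {0..1}) \<Longrightarrow>
    (\<And>\<beta>. \<beta> \<in> nbhd \<alpha> \<Longrightarrow> \<bar>u \<beta> - w \<beta>\<bar> \<le> r) \<Longrightarrow> \<bar>force L u \<alpha> - force L w \<alpha>\<bar> \<le> C * r"
proof -
  obtain M1 where M1: "0 \<le> M1" "\<And>x y x' y'. x \<in> {0..1} \<Longrightarrow> y \<in> {0..1} \<Longrightarrow> x' \<in> {0..1} \<Longrightarrow> y' \<in> {0..1} \<Longrightarrow>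
    \<bar>D1 L x y - D1 L x' y'\<bar> \<le> M1 * (\<bar>x - x'\<bar> + \<bar>y - y'\<bar>)"
    using C1_lipschitz[OF C1_D1L] by blast
  obtain M2 where M2: "0 \<le> M2" "\<And>x y x' y'. x \<in> {0..1} \<Longrightarrow> y \<in> {0..1} \<Longrightarrow> x' \<in> {0..1} \<Longrightarrow> y' \<in> {0..1} \<Longrightarrow>
    \<bar>D2 L x y - D2 L x' y'\<bar> \<le> M2 * (\<bar>x - x'\<bar> + \<bar>y - y'\<bar>)"
    using C1_lipschitz[OF C1_D2L] by blast
  show ?thesis
  proof (rule that[of "real CARD('n) * (M2 * 2 + M1 * 2)"])
    fix u w :: "int ^ 'n \<Rightarrow> real" and \<alpha> r
    assume u: "\<And>\<beta>. u \<beta> \<in> {0..1}" and w: "\<And>\<beta>. w \<beta> \<in> {0..1}"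
      and le: "\<And>\<beta>. \<beta> \<in> nbhd \<alpha> \<Longrightarrow> \<bar>u \<beta> - w \<beta>\<bar> \<le> r"
    let ?f = "\<lambda>u j. D2 L (u (\<alpha> - axis j 1)) (u \<alpha>) + D1 L (u \<alpha>) (u (\<alpha> + axis j 1))"
    have "\<bar>force L u \<alpha> - force L w \<alpha>\<bar> = \<bar>\<Sum>j\<in>UNIV. ?f u j - ?f w j\<bar>"
      by (simp add: force_def sum_subtractf abs_minus_commute)
    also have "\<dots> \<le> (\<Sum>j\<in>UNIV. \<bar>?f u j - ?f w j\<bar>)" by (rule sum_abs)
    also have "\<dots> \<le> (\<Sum>j\<in>(UNIV :: 'n set). M2 * (r + r) + M1 * (r + r))"
    proof (rule sum_mono)
      fix j
      have n: "\<alpha> \<in> nbhd \<alpha>" "\<alpha> - axis j 1 \<in> nbhd \<alpha>" "\<alpha> + axis j 1 \<in> nbhd \<alpha>" by (auto simp: nbhd_def)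
      note d = le[OF n(1)] le[OF n(2)] le[OF n(3)]
      have "\<bar>D2 L (u (\<alpha> - axis j 1)) (u \<alpha>) - D2 L (w (\<alpha> - axis j 1)) (w \<alpha>)\<bar> \<le> M2 * (r + r)"
        by (rule order_trans[OF M2(2) mult_left_mono[OF add_mono M2(1)]]) (fact u w d)+
      moreover have "\<bar>D1 L (u \<alpha>) (u (\<alpha> + axis j 1)) - D1 L (w \<alpha>) (w (\<alpha> + axis j 1))\<bar> \<le> M1 * (r + r)"
        by (rule order_trans[OF M1(2) mult_left_mono[OF add_mono M1(1)]]) (fact u w d)+
      ultimately show "\<bar>?f u j - ?f w j\<bar> \<le> M2 * (r + r) + M1 * (r + r)" by linarith
    qed
    also have "\<dots> = real CARD('n) * (M2 * 2 + M1 * 2) * r" by (simp add: algebra_simps)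
    finally show "\<bar>force L u \<alpha> - force L w \<alpha>\<bar> \<le> real CARD('n) * (M2 * 2 + M1 * 2) * r" .
  qed (use M1 M2 in simp)
qed

lemma force_translate: "force L (\<lambda>\<alpha>. u (\<alpha> + \<beta>)) \<alpha> = force L u (\<alpha> + \<beta>)"
  by (simp add: force_def algebra_simps)

lemma force_reflect: "force L (\<lambda>\<alpha>. 1 - u \<alpha>) \<alpha> = - force L u \<alpha>"
  by (simp add: force_def D_reflect flip: sum_negf)

lemma continuous_force:
  assumes "\<And>\<alpha>. continuous_on S (\<lambda>w. u w \<alpha>)"
  shows "continuous_on S (\<lambda>w. force L (u w) \<alpha>)"
  unfolding force_def
  by (intro continuous_intros C1_compose_continuous[OF C1_D1L] C1_compose_continuous[OF C1_D2L] assms)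

end

subsection \<open>The overdamped and the damped chain\<close>

definition bond_energy :: "(real \<Rightarrow> real \<Rightarrow> real) \<Rightarrow> (int ^ 'n \<Rightarrow> real) \<Rightarrow> real" where
  "bond_energy L u = (\<Sum>j\<in>UNIV. L (u 0) (u (axis j 1)))"

definition bond_flux ::
    "(real \<Rightarrow> real \<Rightarrow> real) \<Rightarrow> 'n \<Rightarrow> (int ^ 'n \<Rightarrow> real) \<Rightarrow> (int ^ 'n \<Rightarrow> real) \<Rightarrow> real" where
  "bond_flux L j u v = D2 L (u 0) (u (axis j 1)) * v (axis j 1)"

lemma has_vector_derivative_pair_iff:
  fixes f :: "real \<Rightarrow> real \<times> real"
  shows "(f has_vector_derivative (a, b)) (at t within S) \<longleftrightarrow>
    ((\<lambda>s. fst (f s)) has_real_derivative a) (at t within S) \<and>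
    ((\<lambda>s. snd (f s)) has_real_derivative b) (at t within S)"
proof
  assume f: "(f has_vector_derivative (a, b)) (at t within S)"
  show "((\<lambda>s. fst (f s)) has_real_derivative a) (at t within S) \<and>
    ((\<lambda>s. snd (f s)) has_real_derivative b) (at t within S)"
    using bounded_linear.has_vector_derivative[OF bounded_linear_fst f]
      bounded_linear.has_vector_derivative[OF bounded_linear_snd f]
    by (simp add: has_real_derivative_iff_has_vector_derivative)
next
  assume "((\<lambda>s. fst (f s)) has_real_derivative a) (at t within S) \<and>
    ((\<lambda>s. snd (f s)) has_real_derivative b) (at t within S)"
  then have "((\<lambda>s. (fst (f s), snd (f s))) has_derivative (\<lambda>h. (h *\<^sub>R a, h *\<^sub>R b))) (at t within S)"
    by (intro has_derivative_Pair)
       (auto simp: has_real_derivative_iff_has_vector_derivative has_vector_derivative_def)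
  then show "(f has_vector_derivative (a, b)) (at t within S)"
    by (simp add: has_vector_derivative_def)
qed

context twist_potential
begin

lemma continuous_bond_energy:
  assumes "\<And>\<alpha>. continuous_on S (\<lambda>w. u w \<alpha>)"
  shows "continuous_on S (\<lambda>w. bond_energy L (u w))"
  unfolding bond_energy_def
  by (intro continuous_on_sum C1_compose_continuous[OF C1_L] assms)

lemma continuous_bond_flux:
  assumes "\<And>\<alpha>. continuous_on S (\<lambda>w. u w \<alpha>)" "\<And>\<alpha>. continuous_on S (\<lambda>w. v w \<alpha>)"
  shows "continuous_on S (\<lambda>w. bond_flux L j (u w) (v w))"
  unfolding bond_flux_def
  by (intro continuous_on_mult C1_compose_continuous[OF C1_D2L] assms)

lemma bond_energy_deriv:
  fixes \<phi> :: "real \<Rightarrow> int ^ 'n::finite \<Rightarrow> real"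
  assumes deriv: "\<And>\<alpha>. ((\<lambda>s. \<phi> s \<alpha>) has_real_derivative v \<alpha>) (at t within S)"
  shows "((\<lambda>s. bond_energy L (\<phi> s)) has_real_derivative
    (\<Sum>j\<in>UNIV. bond_flux L j (\<phi> t) v - bond_flux L j (translate (- axis j 1) (\<phi> t)) (translate (- axis j 1) v))
      - force L (\<phi> t) 0 * v 0) (at t within S)"
proof -
  have "((\<lambda>s. bond_energy L (\<phi> s)) has_real_derivative
    (\<Sum>j\<in>UNIV. D1 L (\<phi> t 0) (\<phi> t (axis j 1)) * v 0 + D2 L (\<phi> t 0) (\<phi> t (axis j 1)) * v (axis j 1))) (at t within S)"
    unfolding bond_energy_def by (intro DERIV_sum C1_chain[OF C1_L] deriv)
  also have "(\<Sum>j\<in>UNIV. D1 L (\<phi> t 0) (\<phi> t (axis j 1)) * v 0 + D2 L (\<phi> t 0) (\<phi> t (axis j 1)) * v (axis j 1))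
    = (\<Sum>j\<in>UNIV. bond_flux L j (\<phi> t) v - bond_flux L j (translate (- axis j 1) (\<phi> t)) (translate (- axis j 1) v))
      - force L (\<phi> t) 0 * v 0"
    by (simp add: bond_flux_def force_def translate_def sum_distrib_right left_diff_distrib distrib_right sum.distrib sum_subtractf)
  finally show ?thesis .
qed

lemma overdamped_system:
  "\<exists>C. dissipative_lattice_system {0..1} (force L) C
     (overdamped_space :: (int ^ 'n::finite \<Rightarrow> real) set) (overdamped_orbits L)
     (bond_energy L) (\<lambda>u. (force L u 0)\<^sup>2) (\<lambda>j u. bond_flux L j u (force L u))"
proof -
  obtain C where C: "0 \<le> C" "\<And>(u :: int ^ 'n \<Rightarrow> real) w \<alpha> r. (\<And>\<beta>. u \<beta> \<in> {0..1}) \<Longrightarrow> (\<And>\<beta>. w \<beta> \<in> {0..1}) \<Longrightarrow>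
    (\<And>\<beta>. \<beta> \<in> nbhd \<alpha> \<Longrightarrow> \<bar>u \<beta> - w \<beta>\<bar> \<le> r) \<Longrightarrow> \<bar>force L u \<alpha> - force L w \<alpha>\<bar> \<le> C * r"
    using force_lipschitz by blast
  have trans: "force L (translate \<beta> u) = translate \<beta> (force L u)" for \<beta> and u :: "int ^ 'n \<Rightarrow> real"
    by (rule ext) (simp add: translate_def force_translate)
  define B where "B = real CARD('n) * curvature_bound L"
  define M where "M = max 1 B"
  have M: "0 < M" "B \<le> M" by (auto simp: M_def)
  define G where "G u \<alpha> = u \<alpha> + force L u \<alpha> / M" for u and \<alpha> :: "int ^ 'n"
  have G_unit: "G u \<alpha> \<in> {0..1}" if u: "\<And>\<beta>. u \<beta> \<in> {0..1}" for u \<alpha>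
  proof -
    have "- (M * u \<alpha>) \<le> force L u \<alpha>" "force L u \<alpha> \<le> M * (1 - u \<alpha>)"
      using force_bounds[of u \<alpha>] u mult_right_mono[OF M(2), of "u \<alpha>"] mult_right_mono[OF M(2), of "1 - u \<alpha>"]
      by (fastforce simp: B_def)+
    then show ?thesis using M(1) by (auto simp: G_def field_simps)
  qed
  have G_lipschitz: "\<bar>G u \<alpha> - G w \<alpha>\<bar> \<le> (1 + C / M) * r"
    if u: "\<And>\<beta>. u \<beta> \<in> {0..1}" and w: "\<And>\<beta>. w \<beta> \<in> {0..1}" and le: "\<And>\<beta>. \<bar>u \<beta> - w \<beta>\<bar> \<le> r" for u w \<alpha> r
  proof -
    have "G u \<alpha> - G w \<alpha> = (u \<alpha> - w \<alpha>) + (force L u \<alpha> - force L w \<alpha>) / M"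
      by (simp add: G_def diff_divide_distrib)
    then have "\<bar>G u \<alpha> - G w \<alpha>\<bar> \<le> \<bar>u \<alpha> - w \<alpha>\<bar> + \<bar>force L u \<alpha> - force L w \<alpha>\<bar> / M"
      using M(1) abs_triangle_ineq[of "u \<alpha> - w \<alpha>" "(force L u \<alpha> - force L w \<alpha>) / M"] by simp
    also have "\<dots> \<le> r + C * r / M"
      using M(1) by (intro add_mono divide_right_mono le C(2)[OF u w]) auto
    finally show ?thesis by (simp add: algebra_simps)
  qed
  have "dissipative_lattice_system {0..1} (force L) C
     (overdamped_space :: (int ^ 'n \<Rightarrow> real) set) (overdamped_orbits L)
     (bond_energy L) (\<lambda>u. (force L u 0)\<^sup>2) (\<lambda>j u. bond_flux L j u (force L u))"
  proof unfold_locales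
    show "(overdamped_space :: (int ^ 'n \<Rightarrow> real) set) = {w. \<forall>\<alpha>. w \<alpha> \<in> {0..1}}"
      by (auto simp: overdamped_space_def)
    show "overdamped_orbits L = {\<phi>. \<forall>t\<ge>0. \<phi> t \<in> overdamped_space \<and>
        (\<forall>\<alpha> :: int ^ 'n. ((\<lambda>s. \<phi> s \<alpha>) has_vector_derivative force L (\<phi> t) \<alpha>) (at t within {0..}))}"
      by (simp add: overdamped_orbits_def has_real_derivative_iff_has_vector_derivative)
    show "force L (translate \<beta> w) = translate \<beta> (force L w)" for \<beta> and w :: "int ^ 'n \<Rightarrow> real"
      by (rule trans)
    show "norm (force L u \<alpha> - force L w \<alpha>) \<le> C * r"
      if "u \<in> overdamped_space" "w \<in> overdamped_space" "\<And>\<beta>. \<beta> \<in> nbhd \<alpha> \<Longrightarrow> norm (u \<beta> - w \<beta>) \<le> r"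
      for u w and \<alpha> :: "int ^ 'n" and r
      using C(2)[of u w \<alpha> r] that by (simp add: overdamped_space_def)
    show "\<exists>\<phi>\<in>overdamped_orbits L. \<phi> 0 = w" if "w \<in> overdamped_space" for w :: "int ^ 'n \<Rightarrow> real"
    proof -
      have "\<exists>\<phi>. \<phi> 0 = w \<and> (\<forall>t\<ge>0. \<forall>\<alpha>. \<phi> t \<alpha> \<in> {0..1} \<and>
          ((\<lambda>s. \<phi> s \<alpha>) has_real_derivative M * (G (\<phi> t) \<alpha> - \<phi> t \<alpha>)) (at t within {0..}))"
        using M(1) C(1) that
        by (intro cube_flow_exists[where C = "1 + C / M"] G_unit G_lipschitz)
           (auto simp: overdamped_space_def)
      moreover have "M * (G u \<alpha> - u \<alpha>) = force L u \<alpha>" for u \<alpha>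
        using M(1) by (simp add: G_def)
      ultimately obtain \<phi> where "\<phi> 0 = w" and \<phi>: "\<And>t \<alpha>. 0 \<le> t \<Longrightarrow> \<phi> t \<alpha> \<in> {0..1}"
          "\<And>t \<alpha>. 0 \<le> t \<Longrightarrow> ((\<lambda>s. \<phi> s \<alpha>) has_real_derivative force L (\<phi> t) \<alpha>) (at t within {0..})"
        by (simp only:) blast
      moreover have "\<phi> \<in> overdamped_orbits L"
        using \<phi> by (auto simp: overdamped_orbits_def overdamped_space_def)
      ultimately show ?thesis by blast
    qed
    show "((\<lambda>s. bond_energy L (\<phi> s)) has_real_derivative
        (\<Sum>j\<in>UNIV. bond_flux L j (\<phi> t) (force L (\<phi> t)) -
          bond_flux L j (translate (- axis j 1) (\<phi> t)) (force L (translate (- axis j 1) (\<phi> t))))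
        - (force L (\<phi> t) 0)\<^sup>2) (at t within {0..})"
      if "\<phi> \<in> overdamped_orbits L" "0 \<le> t" for \<phi> :: "real \<Rightarrow> int ^ 'n \<Rightarrow> real" and t
    proof -
      have "((\<lambda>s. \<phi> s \<alpha>) has_real_derivative force L (\<phi> t) \<alpha>) (at t within {0..})" for \<alpha>
        using that by (simp add: overdamped_orbits_def)
      from bond_energy_deriv[OF this] show ?thesis
        by (simp add: trans power2_eq_square)
    qed
    show "force L (\<phi> 0) = (\<lambda>_. 0)"
      if "\<And>t \<beta>. t \<in> {0..1} \<Longrightarrow> (force L (translate \<beta> (\<phi> t)) 0)\<^sup>2 = 0" for \<phi> :: "real \<Rightarrow> int ^ 'n \<Rightarrow> real"
      using that[of 0] by (simp add: fun_eq_iff translate_def force_translate)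
    show "continuous_on overdamped_space (bond_energy L :: (int ^ 'n \<Rightarrow> real) \<Rightarrow> real)"
      by (rule continuous_bond_energy[OF continuous_on_coordinate])
    show "continuous_on overdamped_space (\<lambda>u :: int ^ 'n \<Rightarrow> real. (force L u 0)\<^sup>2)"
      by (intro continuous_on_power continuous_force continuous_on_coordinate)
    show "continuous_on overdamped_space (\<lambda>u. bond_flux L j u (force L u))" for j :: 'n
      by (rule continuous_bond_flux[OF continuous_on_coordinate continuous_force[OF continuous_on_coordinate]])
  qed (rule compact_Icc, rule zero_le_power2)
  then show ?thesis by (rule exI[of _ C])
qed

lemma damped_orbit_exists:
  fixes w :: "int ^ 'n::finite \<Rightarrow> real \<times> real"
  assumes lam: "0 < lam" and damping: "4 * lam * real CARD('n) * curvature_bound L \<le> 1"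
    and w: "w \<in> damped_space lam"
  shows "\<exists>\<phi>\<in>damped_orbits lam L. \<phi> 0 = w"
proof -
  obtain C where C: "0 \<le> C" "\<And>(u :: int ^ 'n \<Rightarrow> real) w \<alpha> r. (\<And>\<beta>. u \<beta> \<in> {0..1}) \<Longrightarrow> (\<And>\<beta>. w \<beta> \<in> {0..1}) \<Longrightarrow>
    (\<And>\<beta>. \<beta> \<in> nbhd \<alpha> \<Longrightarrow> \<bar>u \<beta> - w \<beta>\<bar> \<le> r) \<Longrightarrow> \<bar>force L u \<alpha> - force L w \<alpha>\<bar> \<le> C * r"
    using force_lipschitz by blast
  define B where "B = real CARD('n) * curvature_bound L"
  define M where "M = 1 / (2 * lam)"
  have M: "0 < M" using lam by (simp add: M_def)
  have B: "4 * lam * B \<le> 1" using damping by (simp add: B_def mult.assoc)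
  \<comment> \<open>\<open>U (\<alpha>, False)\<close> is \<open>u(\<alpha>)\<close> and \<open>U (\<alpha>, True)\<close> is \<open>2 \<lambda> v(\<alpha>) + u(\<alpha>)\<close>.\<close>
  define G :: "((int ^ 'n) \<times> bool \<Rightarrow> real) \<Rightarrow> (int ^ 'n) \<times> bool \<Rightarrow> real" where
    "G U i = (if snd i then U (fst i, False) + 4 * lam * force L (\<lambda>\<beta>. U (\<beta>, False)) (fst i) else U (fst i, True))" for U i
  have G_unit: "G U i \<in> {0..1}" if U: "\<And>j. U j \<in> {0..1}" for U i
  proof -
    obtain \<alpha> b where i: "i = (\<alpha>, b)" by (cases i)
    let ?u = "\<lambda>\<beta>. U (\<beta>, False)"
    have "4 * lam * (- (B * ?u \<alpha>)) \<le> 4 * lam * force L ?u \<alpha>"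
      and upper: "4 * lam * force L ?u \<alpha> \<le> 4 * lam * (B * (1 - ?u \<alpha>))"
      using force_bounds[of ?u \<alpha>] U lam by (intro mult_left_mono; simp add: B_def)+
    then have lower: "- (4 * lam * (B * ?u \<alpha>)) \<le> 4 * lam * force L ?u \<alpha>" by simp
    have "4 * lam * B * ?u \<alpha> \<le> 1 * ?u \<alpha>" "4 * lam * B * (1 - ?u \<alpha>) \<le> 1 * (1 - ?u \<alpha>)"
      using U[of "(\<alpha>, False)"] B by (intro mult_right_mono; simp)+
    then have "4 * lam * (B * ?u \<alpha>) \<le> ?u \<alpha>" "4 * lam * (B * (1 - ?u \<alpha>)) \<le> 1 - ?u \<alpha>"
      by (simp_all only: mult.assoc mult_1)
    with lower upper have "0 \<le> ?u \<alpha> + 4 * lam * force L ?u \<alpha>" "?u \<alpha> + 4 * lam * force L ?u \<alpha> \<le> 1"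
      by linarith+
    then show ?thesis using U[of "(\<alpha>, True)"] by (simp add: G_def i)
  qed
  have G_lipschitz: "\<bar>G U i - G W i\<bar> \<le> (1 + 4 * lam * C) * r"
    if U: "\<And>j. U j \<in> {0..1}" and W: "\<And>j. W j \<in> {0..1}" and le: "\<And>j. \<bar>U j - W j\<bar> \<le> r" for U W i r
  proof -
    obtain \<alpha> b where i: "i = (\<alpha>, b)" by (cases i)
    let ?F = "\<lambda>U. force L (\<lambda>\<beta>. U (\<beta>, False)) \<alpha>"
    have r: "0 \<le> r" using le[of i] by linarith
    have "\<bar>?F U - ?F W\<bar> \<le> C * r" by (intro C(2) U W le)
    then have F: "\<bar>4 * lam * (?F U - ?F W)\<bar> \<le> 4 * lam * (C * r)"
      using lam by (simp add: abs_mult)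
    have nonneg: "0 \<le> 4 * lam * (C * r)" using lam C(1) r by simp
    show ?thesis
    proof (cases b)
      case True
      have "G U i - G W i = (U (\<alpha>, False) - W (\<alpha>, False)) + 4 * lam * (?F U - ?F W)"
        by (simp add: G_def i True algebra_simps)
      then have "\<bar>G U i - G W i\<bar> \<le> r + 4 * lam * (C * r)"
        using le[of "(\<alpha>, False)"] F by linarith
      then show ?thesis by (simp add: algebra_simps)
    next
      case False
      have "G U i - G W i = U (\<alpha>, True) - W (\<alpha>, True)"
        by (simp add: G_def i False)
      then have "\<bar>G U i - G W i\<bar> \<le> r + 4 * lam * (C * r)"
        using le[of "(\<alpha>, True)"] nonneg by linarith
      then show ?thesis by (simp add: algebra_simps)
    qed
  qed
  define a where "a i = (if snd i then 2 * lam * snd (w (fst i)) + fst (w (fst i)) else fst (w (fst i)))"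
    for i :: "(int ^ 'n) \<times> bool"
  have "a i \<in> {0..1}" for i using w by (simp add: a_def damped_space_def)
  then have "\<exists>\<phi>. \<phi> 0 = a \<and> (\<forall>t\<ge>0. \<forall>i. \<phi> t i \<in> {0..1} \<and>
     ((\<lambda>s. \<phi> s i) has_real_derivative M * (G (\<phi> t) i - \<phi> t i)) (at t within {0..}))"
    using M C(1) lam by (intro cube_flow_exists[where C = "1 + 4 * lam * C"] G_unit G_lipschitz) auto
  then obtain \<phi> where \<phi>0: "\<phi> 0 = a" and \<phi>_unit: "\<And>t i. 0 \<le> t \<Longrightarrow> \<phi> t i \<in> {0..1}"
    and \<phi>: "\<And>t i. 0 \<le> t \<Longrightarrow> ((\<lambda>s. \<phi> s i) has_real_derivative M * (G (\<phi> t) i - \<phi> t i)) (at t within {0..})"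
    by blast
  define \<psi> where "\<psi> t \<alpha> = (\<phi> t (\<alpha>, False), M * (\<phi> t (\<alpha>, True) - \<phi> t (\<alpha>, False)))" for t \<alpha>
  have lamM: "2 * lam * M = 1" using lam by (simp add: M_def)
  have "\<psi> 0 = w"
  proof
    fix \<alpha>
    have "M * (2 * lam * snd (w \<alpha>)) = (2 * lam * M) * snd (w \<alpha>)" by simp
    also have "\<dots> = snd (w \<alpha>)" unfolding lamM by simp
    finally show "\<psi> 0 \<alpha> = w \<alpha>" by (simp add: \<psi>_def \<phi>0 a_def prod_eq_iff)
  qed
  moreover have "\<psi> \<in> damped_orbits lam L"
    unfolding damped_orbits_def
  proof (intro CollectI allI impI conjI)
    fix t :: real assume t: "0 \<le> t"
    have *: "2 * lam * (M * x) = x" for x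
      using lam by (simp add: M_def)
    show "\<psi> t \<in> damped_space lam"
      using \<phi>_unit[OF t] by (simp add: damped_space_def \<psi>_def *)
    fix \<alpha>
    show "((\<lambda>s. fst (\<psi> s \<alpha>)) has_real_derivative snd (\<psi> t \<alpha>)) (at t within {0..})"
      using \<phi>[OF t, of "(\<alpha>, False)"] by (simp add: \<psi>_def G_def)
    have "((\<lambda>s. M * (\<phi> s (\<alpha>, True) - \<phi> s (\<alpha>, False))) has_real_derivative
        M * (M * (G (\<phi> t) (\<alpha>, True) - \<phi> t (\<alpha>, True)) - M * (G (\<phi> t) (\<alpha>, False) - \<phi> t (\<alpha>, False)))) (at t within {0..})"
      by (intro DERIV_cmult DERIV_diff \<phi>[OF t])
    also have "M * (M * (G (\<phi> t) (\<alpha>, True) - \<phi> t (\<alpha>, True)) - M * (G (\<phi> t) (\<alpha>, False) - \<phi> t (\<alpha>, False)))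
        = (force L (\<lambda>\<beta>. fst (\<psi> t \<beta>)) \<alpha> - snd (\<psi> t \<alpha>)) / lam"
      using lam by (simp add: G_def \<psi>_def M_def field_simps)
    finally show "((\<lambda>s. snd (\<psi> s \<alpha>)) has_real_derivative
        (force L (\<lambda>\<beta>. fst (\<psi> t \<beta>)) \<alpha> - snd (\<psi> t \<alpha>)) / lam) (at t within {0..})"
      by (simp add: \<psi>_def)
  qed
  ultimately show ?thesis by blast
qed

lemma damped_system:
  assumes lam: "0 < lam"
    and exist: "\<And>w :: int ^ 'n::finite \<Rightarrow> real \<times> real. w \<in> damped_space lam \<Longrightarrow> \<exists>\<phi>\<in>damped_orbits lam L. \<phi> 0 = w"
  shows "\<exists>C. dissipative_lattice_system
     {p. 0 \<le> fst p \<and> fst p \<le> 1 \<and> 0 \<le> 2 * lam * snd p + fst p \<and> 2 * lam * snd p + fst p \<le> 1}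
     (\<lambda>w \<alpha>. (snd (w \<alpha>), (force L (\<lambda>\<beta>. fst (w \<beta>)) \<alpha> - snd (w \<alpha>)) / lam)) C
     (damped_space lam :: (int ^ 'n \<Rightarrow> real \<times> real) set) (damped_orbits lam L)
     (\<lambda>w. lam / 2 * (snd (w 0))\<^sup>2 + bond_energy L (\<lambda>\<alpha>. fst (w \<alpha>))) (\<lambda>w. (snd (w 0))\<^sup>2)
     (\<lambda>j w. bond_flux L j (\<lambda>\<alpha>. fst (w \<alpha>)) (\<lambda>\<alpha>. snd (w \<alpha>)))"
proof -
  let ?K = "{p. 0 \<le> fst p \<and> fst p \<le> 1 \<and> 0 \<le> 2 * lam * snd p + fst p \<and> 2 * lam * snd p + fst p \<le> 1}"
  let ?V = "\<lambda>(w :: int ^ 'n \<Rightarrow> real \<times> real) \<alpha>. (snd (w \<alpha>), (force L (\<lambda>\<beta>. fst (w \<beta>)) \<alpha> - snd (w \<alpha>)) / lam)"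
  obtain C where C: "0 \<le> C" "\<And>(u :: int ^ 'n \<Rightarrow> real) w \<alpha> r. (\<And>\<beta>. u \<beta> \<in> {0..1}) \<Longrightarrow> (\<And>\<beta>. w \<beta> \<in> {0..1}) \<Longrightarrow>
    (\<And>\<beta>. \<beta> \<in> nbhd \<alpha> \<Longrightarrow> \<bar>u \<beta> - w \<beta>\<bar> \<le> r) \<Longrightarrow> \<bar>force L u \<alpha> - force L w \<alpha>\<bar> \<le> C * r"
    using force_lipschitz by blast
  have cont_coord: "continuous_on S (\<lambda>w. fst (w \<alpha>))" "continuous_on S (\<lambda>w. snd (w \<alpha>))"
    for S :: "(int ^ 'n \<Rightarrow> real \<times> real) set" and \<alpha>
    by (rule continuous_on_fst[OF continuous_on_coordinate] continuous_on_snd[OF continuous_on_coordinate])+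
  have "dissipative_lattice_system ?K ?V (1 + (C + 1) / lam)
     (damped_space lam :: (int ^ 'n \<Rightarrow> real \<times> real) set) (damped_orbits lam L)
     (\<lambda>w. lam / 2 * (snd (w 0))\<^sup>2 + bond_energy L (\<lambda>\<alpha>. fst (w \<alpha>))) (\<lambda>w. (snd (w 0))\<^sup>2)
     (\<lambda>j w. bond_flux L j (\<lambda>\<alpha>. fst (w \<alpha>)) (\<lambda>\<alpha>. snd (w \<alpha>)))"
  proof unfold_locales
    show "compact ?K"
    proof -
      have "?K = (\<lambda>(u, p). (u, (p - u) / (2 * lam))) ` ({0..1} \<times> {0..1})"
      proof
        show "?K \<subseteq> (\<lambda>(u, p). (u, (p - u) / (2 * lam))) ` ({0..1} \<times> {0..1})"
        proof
          fix p assume "p \<in> ?K"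
          then show "p \<in> (\<lambda>(u, p). (u, (p - u) / (2 * lam))) ` ({0..1} \<times> {0..1})"
            using lam by (intro image_eqI[of _ _ "(fst p, 2 * lam * snd p + fst p)"]) auto
        qed
      qed (use lam in auto)
      also have "compact \<dots>"
        using lam unfolding case_prod_unfold
        by (intro compact_continuous_image compact_Times continuous_intros) auto
      finally show ?thesis .
    qed
    show "damped_space lam = {w :: int ^ 'n \<Rightarrow> _. \<forall>\<alpha>. w \<alpha> \<in> ?K}"
      by (auto simp: damped_space_def)
    show "damped_orbits lam L = {\<phi>. \<forall>t\<ge>0. \<phi> t \<in> damped_space lam \<and>
        (\<forall>\<alpha> :: int ^ 'n. ((\<lambda>s. \<phi> s \<alpha>) has_vector_derivative ?V (\<phi> t) \<alpha>) (at t within {0..}))}"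
      by (simp add: damped_orbits_def has_vector_derivative_pair_iff)
    show "?V (translate \<beta> w) = translate \<beta> (?V w)" for \<beta> and w
      by (simp add: fun_eq_iff translate_def force_translate[of "\<lambda>\<beta>. fst (w \<beta>)"])
    show "norm (?V u \<alpha> - ?V w \<alpha>) \<le> (1 + (C + 1) / lam) * r"
      if u: "u \<in> damped_space lam" and w: "w \<in> damped_space lam"
        and le: "\<And>\<beta>. \<beta> \<in> nbhd \<alpha> \<Longrightarrow> norm (u \<beta> - w \<beta>) \<le> r"
      for u w and \<alpha> :: "int ^ 'n" and r
    proof -
      have le1: "\<bar>fst (u \<beta>) - fst (w \<beta>)\<bar> \<le> r" "\<bar>snd (u \<beta>) - snd (w \<beta>)\<bar> \<le> r" if "\<beta> \<in> nbhd \<alpha>" for \<beta>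
        using le[OF that] dist_fst_le[of "u \<beta>" "w \<beta>"] dist_snd_le[of "u \<beta>" "w \<beta>"]
        by (simp_all add: dist_norm)
      have \<alpha>: "\<alpha> \<in> nbhd \<alpha>" by (simp add: nbhd_def)
      let ?F = "\<lambda>w :: int ^ 'n \<Rightarrow> real \<times> real. force L (\<lambda>\<beta>. fst (w \<beta>)) \<alpha>"
      have F: "\<bar>?F u - ?F w\<bar> \<le> C * r"
        using u w le1 by (intro C(2)) (auto simp: damped_space_def)
      have "?V u \<alpha> - ?V w \<alpha> = (snd (u \<alpha>) - snd (w \<alpha>), ((?F u - ?F w) - (snd (u \<alpha>) - snd (w \<alpha>))) / lam)"
        by (simp add: diff_divide_distrib)
      then have "norm (?V u \<alpha> - ?V w \<alpha>) \<le> \<bar>snd (u \<alpha>) - snd (w \<alpha>)\<bar> + \<bar>(?F u - ?F w) - (snd (u \<alpha>) - snd (w \<alpha>))\<bar> / lam"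
        using norm_Pair_le[of "snd (u \<alpha>) - snd (w \<alpha>)" "((?F u - ?F w) - (snd (u \<alpha>) - snd (w \<alpha>))) / lam"] lam
        by simp
      also have "\<dots> \<le> r + (C * r + r) / lam"
        using le1(2)[OF \<alpha>] F lam by (intro add_mono divide_right_mono) linarith+
      also have "\<dots> = (1 + (C + 1) / lam) * r" using lam by (simp add: field_simps)
      finally show ?thesis .
    qed
    show "\<exists>\<phi>\<in>damped_orbits lam L. \<phi> 0 = w" if "w \<in> damped_space lam" for w :: "int ^ 'n \<Rightarrow> real \<times> real"
      using that by (rule exist)
    show "((\<lambda>s. lam / 2 * (snd (\<phi> s 0))\<^sup>2 + bond_energy L (\<lambda>\<alpha>. fst (\<phi> s \<alpha>))) has_real_derivative
        (\<Sum>j\<in>UNIV. bond_flux L j (\<lambda>\<alpha>. fst (\<phi> t \<alpha>)) (\<lambda>\<alpha>. snd (\<phi> t \<alpha>)) -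
          bond_flux L j (\<lambda>\<alpha>. fst (translate (- axis j 1) (\<phi> t) \<alpha>)) (\<lambda>\<alpha>. snd (translate (- axis j 1) (\<phi> t) \<alpha>)))
        - (snd (\<phi> t 0))\<^sup>2) (at t within {0..})"
      if "\<phi> \<in> damped_orbits lam L" "0 \<le> t" for \<phi> :: "real \<Rightarrow> int ^ 'n \<Rightarrow> real \<times> real" and t
    proof -
      let ?F = "force L (\<lambda>\<beta>. fst (\<phi> t \<beta>)) 0"
      have u: "((\<lambda>s. fst (\<phi> s \<alpha>)) has_real_derivative snd (\<phi> t \<alpha>)) (at t within {0..})" for \<alpha>
        using that by (simp add: damped_orbits_def)
      have v: "((\<lambda>s. snd (\<phi> s 0)) has_real_derivative (?F - snd (\<phi> t 0)) / lam) (at t within {0..})"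
        using that by (simp add: damped_orbits_def)
      have "((\<lambda>s. lam / 2 * (snd (\<phi> s 0))\<^sup>2) has_real_derivative lam / 2 * (2 * ((?F - snd (\<phi> t 0)) / lam * snd (\<phi> t 0)))) (at t within {0..})"
        using v by (auto intro!: derivative_eq_intros)
      also have "lam / 2 * (2 * ((?F - snd (\<phi> t 0)) / lam * snd (\<phi> t 0))) = ?F * snd (\<phi> t 0) - (snd (\<phi> t 0))\<^sup>2"
        using lam by (simp add: power2_eq_square left_diff_distrib)
      finally have "((\<lambda>s. lam / 2 * (snd (\<phi> s 0))\<^sup>2) has_real_derivative ?F * snd (\<phi> t 0) - (snd (\<phi> t 0))\<^sup>2) (at t within {0..})" .
      from DERIV_add[OF this bond_energy_deriv[of "\<lambda>s \<alpha>. fst (\<phi> s \<alpha>)" "\<lambda>\<alpha>. snd (\<phi> t \<alpha>)", OF u]]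
      show ?thesis by (simp add: translate_def)
    qed
    show "?V (\<phi> 0) = (\<lambda>_. 0)"
      if \<phi>: "\<phi> \<in> damped_orbits lam L"
        and zero: "\<And>t \<beta>. t \<in> {0..1} \<Longrightarrow> (snd (translate \<beta> (\<phi> t) 0))\<^sup>2 = 0" for \<phi>
    proof
      fix \<alpha>
      have v: "snd (\<phi> s \<alpha>) = 0" if "s \<in> {0..1}" for s
        using zero[OF that, of \<alpha>] by (simp add: translate_def)
      have "((\<lambda>s. snd (\<phi> s \<alpha>)) has_real_derivative
          (force L (\<lambda>\<beta>. fst (\<phi> 0 \<beta>)) \<alpha> - snd (\<phi> 0 \<alpha>)) / lam) (at 0 within {0..1})"
        by (rule DERIV_subset[of _ _ _ "{0..}"]) (use \<phi> in \<open>auto simp: damped_orbits_def\<close>)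
      then have d: "((\<lambda>s. 0) has_real_derivative (force L (\<lambda>\<beta>. fst (\<phi> 0 \<beta>)) \<alpha> - snd (\<phi> 0 \<alpha>)) / lam) (at 0 within {0..1})"
        by (rule has_field_derivative_transform_within[OF _ zero_less_one]) (use v in auto)
      have "at 0 within {0..1::real} \<noteq> bot"
        by (simp add: at_within_Icc_at_right)
      then have "(force L (\<lambda>\<beta>. fst (\<phi> 0 \<beta>)) \<alpha> - snd (\<phi> 0 \<alpha>)) / lam = 0"
        by (rule vector_derivative_unique_within[OF _ d[unfolded has_real_derivative_iff_has_vector_derivative]
              has_vector_derivative_const])
      then show "?V (\<phi> 0) \<alpha> = 0" using v[of 0] by (simp add: zero_prod_def)
    qed
    show "continuous_on (damped_space lam) (\<lambda>w :: int ^ 'n \<Rightarrow> real \<times> real.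
        lam / 2 * (snd (w 0))\<^sup>2 + bond_energy L (\<lambda>\<alpha>. fst (w \<alpha>)))"
      by (intro continuous_on_add continuous_on_mult continuous_on_const continuous_on_power
          continuous_bond_energy cont_coord)
    show "continuous_on (damped_space lam) (\<lambda>w :: int ^ 'n \<Rightarrow> real \<times> real. (snd (w 0))\<^sup>2)"
      by (intro continuous_on_power cont_coord)
    show "continuous_on (damped_space lam) (\<lambda>w. bond_flux L j (\<lambda>\<alpha>. fst (w \<alpha>)) (\<lambda>\<alpha>. snd (w \<alpha>)))" for j :: 'n
      by (intro continuous_bond_flux cont_coord)
  qed (rule zero_le_power2)
  then show ?thesis by (rule exI[of _ "1 + (C + 1) / lam"])
qed

end

theorem theorem5:
  fixes L :: "real \<Rightarrow> real \<Rightarrow> real" and lam :: real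
  assumes N: "CARD('n::finite) \<in> {1, 2}"
    and lam: "0 \<le> lam"
    and smooth: "C2 L"
    and L1: "\<And>(x::real) (y::real) (k::int). L x y = L (x + of_int k) (y + of_int k)"
    and L2: "filterlim (\<lambda>(x, y). L x y) at_top (filtercomap (\<lambda>(x, y). \<bar>x - y\<bar>) at_top)"
    and L3: "\<And>x y. \<not> (\<exists>k::int. x = of_int k \<and> y = of_int k) \<Longrightarrow> L 0 0 < L x y"
    and L4: "\<And>x y. D2 (D1 L) x y \<le> 0"
    and L5: "\<And>x y. L x y = L (- x) (- y)"
    and L6: "4 * lam * curvature_bound L \<le> 1"
    and well_posed: "4 * lam * real CARD('n) * curvature_bound L > 1 \<Longrightarrow>
      \<forall>w \<in> (damped_space lam :: (int ^ 'n \<Rightarrow> real \<times> real) set).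
        \<exists>\<phi> \<in> damped_orbits lam L. \<phi> 0 = w"
  shows
    "(lam = 0 \<longrightarrow>
       (\<forall>\<mu> :: (int ^ 'n \<Rightarrow> real) measure.
          let X = overdamped_space; orbs = overdamped_orbits L;
              w0 = (\<lambda>_. 0); w1 = (\<lambda>_. 1)
          in borel_probability_on X \<mu> \<longrightarrow>
             translation_ergodic \<mu> \<longrightarrow>
             invariant_under overdamped_reflect \<mu> \<longrightarrow>
             (AE w in \<mu>. omega_limit orbs w \<inter>
                (equilibria X orbs - asymptotic_equilibria X orbs w0 w1) = {}) \<longrightarrow>
             (AE w in \<mu>. w0 \<in> omega_limit orbs w \<and> w1 \<in> omega_limit orbs w)))
     \<and>
     (0 < lam \<longrightarrow>
       (\<forall>\<mu> :: (int ^ 'n \<Rightarrow> real \<times> real) measure.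
          let X = damped_space lam; orbs = damped_orbits lam L;
              w0 = (\<lambda>_. (0, 0)); w1 = (\<lambda>_. (1, 0))
          in borel_probability_on X \<mu> \<longrightarrow>
             translation_ergodic \<mu> \<longrightarrow>
             invariant_under damped_reflect \<mu> \<longrightarrow>
             (AE w in \<mu>. omega_limit orbs w \<inter>
                (equilibria X orbs - asymptotic_equilibria X orbs w0 w1) = {}) \<longrightarrow>
             (AE w in \<mu>. w0 \<in> omega_limit orbs w \<and> w1 \<in> omega_limit orbs w)))"
proof -
  interpret twist_potential L
    using smooth L1 L3 L4 L5 by unfold_locales
  have "AE w in \<mu>. (\<lambda>_. 0) \<in> omega_limit (overdamped_orbits L) w \<and> (\<lambda>_. 1) \<in> omega_limit (overdamped_orbits L) w"
    if "borel_probability_on overdamped_space \<mu>" "translation_ergodic \<mu>" "invariant_under overdamped_reflect \<mu>"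
      "AE w in \<mu>. omega_limit (overdamped_orbits L) w \<inter> (equilibria overdamped_space (overdamped_orbits L) -
          asymptotic_equilibria overdamped_space (overdamped_orbits L) (\<lambda>_. 0) (\<lambda>_. 1)) = {}"
    for \<mu> :: "(int ^ 'n \<Rightarrow> real) measure"
  proof -
    obtain C where "dissipative_lattice_system {0..1} (force L) C
        (overdamped_space :: (int ^ 'n \<Rightarrow> real) set) (overdamped_orbits L)
        (bond_energy L) (\<lambda>u. (force L u 0)\<^sup>2) (\<lambda>j u. bond_flux L j u (force L u))"
      using overdamped_system by blast
    then interpret S: dissipative_lattice_system "{0..1}" "force L" C
        "overdamped_space :: (int ^ 'n \<Rightarrow> real) set" "overdamped_orbits L"
        "bond_energy L" "\<lambda>u. (force L u 0)\<^sup>2" "\<lambda>j u. bond_flux L j u (force L u)" .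
    show ?thesis
    proof (rule S.AE_omega_contains[OF that(1,2) _ _ _ _ _ _ that(3,4)])
      show "continuous_on overdamped_space overdamped_reflect"
        unfolding overdamped_reflect_def
        by (intro continuous_on_coordinatewise_then_product continuous_on_diff continuous_on_const continuous_on_coordinate)
      show "(\<lambda>t. overdamped_reflect (\<phi> t)) \<in> overdamped_orbits L"
        if "\<phi> \<in> overdamped_orbits L" for \<phi> :: "real \<Rightarrow> int ^ 'n \<Rightarrow> real"
        unfolding overdamped_orbits_def
      proof (intro CollectI allI impI conjI)
        fix t :: real assume t: "0 \<le> t"
        show "overdamped_reflect (\<phi> t) \<in> overdamped_space"
          using that t by (simp add: overdamped_orbits_def overdamped_space_def overdamped_reflect_def)
        fix \<alpha>
        have "((\<lambda>s. \<phi> s \<alpha>) has_real_derivative force L (\<phi> t) \<alpha>) (at t within {0..})"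
          using that t by (simp add: overdamped_orbits_def)
        from DERIV_diff[OF DERIV_const this]
        show "((\<lambda>s. overdamped_reflect (\<phi> s) \<alpha>) has_real_derivative force L (overdamped_reflect (\<phi> t)) \<alpha>) (at t within {0..})"
          by (simp add: overdamped_reflect_def force_reflect)
      qed
    qed (auto simp: overdamped_reflect_def overdamped_space_def translate_def)
  qed
  moreover have "AE w in \<mu>. (\<lambda>_. (0, 0)) \<in> omega_limit (damped_orbits lam L) w \<and> (\<lambda>_. (1, 0)) \<in> omega_limit (damped_orbits lam L) w"
    if "0 < lam" "borel_probability_on (damped_space lam) \<mu>" "translation_ergodic \<mu>" "invariant_under damped_reflect \<mu>"
      "AE w in \<mu>. omega_limit (damped_orbits lam L) w \<inter> (equilibria (damped_space lam) (damped_orbits lam L) -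
          asymptotic_equilibria (damped_space lam) (damped_orbits lam L) (\<lambda>_. (0, 0)) (\<lambda>_. (1, 0))) = {}"
    for \<mu> :: "(int ^ 'n \<Rightarrow> real \<times> real) measure"
  proof -
    have exist: "\<exists>\<phi>\<in>damped_orbits lam L. \<phi> 0 = w" if "w \<in> damped_space lam" for w :: "int ^ 'n \<Rightarrow> real \<times> real"
    proof (cases "4 * lam * real CARD('n) * curvature_bound L \<le> 1")
      case True
      then show ?thesis by (rule damped_orbit_exists[OF \<open>0 < lam\<close> _ that])
    next
      case False
      then show ?thesis using well_posed that by auto
    qed
    let ?K = "{p. 0 \<le> fst p \<and> fst p \<le> 1 \<and> 0 \<le> 2 * lam * snd p + fst p \<and> 2 * lam * snd p + fst p \<le> 1}"
    let ?V = "\<lambda>w \<alpha>. (snd (w \<alpha>), (force L (\<lambda>\<beta>. fst (w \<beta>)) \<alpha> - snd (w \<alpha>)) / lam)"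
    obtain C where "dissipative_lattice_system ?K ?V C
        (damped_space lam :: (int ^ 'n \<Rightarrow> real \<times> real) set) (damped_orbits lam L)
        (\<lambda>w. lam / 2 * (snd (w 0))\<^sup>2 + bond_energy L (\<lambda>\<alpha>. fst (w \<alpha>))) (\<lambda>w. (snd (w 0))\<^sup>2)
        (\<lambda>j w. bond_flux L j (\<lambda>\<alpha>. fst (w \<alpha>)) (\<lambda>\<alpha>. snd (w \<alpha>)))"
      using damped_system[OF \<open>0 < lam\<close> exist] by blast
    then interpret S: dissipative_lattice_system ?K ?V C
        "damped_space lam :: (int ^ 'n \<Rightarrow> real \<times> real) set" "damped_orbits lam L"
        "\<lambda>w. lam / 2 * (snd (w 0))\<^sup>2 + bond_energy L (\<lambda>\<alpha>. fst (w \<alpha>))" "\<lambda>w. (snd (w 0))\<^sup>2"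
        "\<lambda>j w. bond_flux L j (\<lambda>\<alpha>. fst (w \<alpha>)) (\<lambda>\<alpha>. snd (w \<alpha>))" .
    have damped_reflect_in_space: "damped_reflect w \<in> damped_space lam"
      if "w \<in> damped_space lam" for w :: "int ^ 'n \<Rightarrow> real \<times> real"
      unfolding damped_space_def
    proof (intro CollectI allI)
      fix \<alpha>
      have "0 \<le> fst (w \<alpha>) \<and> fst (w \<alpha>) \<le> 1 \<and> 0 \<le> 2 * lam * snd (w \<alpha>) + fst (w \<alpha>) \<and> 2 * lam * snd (w \<alpha>) + fst (w \<alpha>) \<le> 1"
        using that by (simp add: damped_space_def)
      then show "0 \<le> fst (damped_reflect w \<alpha>) \<and> fst (damped_reflect w \<alpha>) \<le> 1 \<and>
          0 \<le> 2 * lam * snd (damped_reflect w \<alpha>) + fst (damped_reflect w \<alpha>) \<and>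
          2 * lam * snd (damped_reflect w \<alpha>) + fst (damped_reflect w \<alpha>) \<le> 1"
        by (simp add: damped_reflect_def)
    qed
    show ?thesis
    proof (rule S.AE_omega_contains[OF that(2,3) _ _ _ _ _ _ that(4,5)])
      show "continuous_on (damped_space lam) damped_reflect"
        unfolding damped_reflect_def
        by (intro continuous_on_coordinatewise_then_product continuous_on_Pair continuous_on_diff continuous_on_minus
            continuous_on_const continuous_on_fst continuous_on_snd continuous_on_coordinate)
      show "(\<lambda>t. damped_reflect (\<phi> t)) \<in> damped_orbits lam L"
        if \<phi>: "\<phi> \<in> damped_orbits lam L" for \<phi> :: "real \<Rightarrow> int ^ 'n \<Rightarrow> real \<times> real"
        unfolding damped_orbits_def
      proof (intro CollectI allI impI conjI)
        fix t :: real assume t: "0 \<le> t"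
        have "\<phi> t \<in> damped_space lam" using \<phi> t by (simp add: damped_orbits_def)
        then show "damped_reflect (\<phi> t) \<in> damped_space lam"
          by (rule damped_reflect_in_space)
        fix \<alpha>
        have u: "((\<lambda>s. fst (\<phi> s \<alpha>)) has_real_derivative snd (\<phi> t \<alpha>)) (at t within {0..})"
          and v: "((\<lambda>s. snd (\<phi> s \<alpha>)) has_real_derivative
            (force L (\<lambda>\<beta>. fst (\<phi> t \<beta>)) \<alpha> - snd (\<phi> t \<alpha>)) / lam) (at t within {0..})"
          using \<phi> t by (auto simp: damped_orbits_def)
        show "((\<lambda>s. fst (damped_reflect (\<phi> s) \<alpha>)) has_real_derivative snd (damped_reflect (\<phi> t) \<alpha>)) (at t within {0..})"
          using DERIV_diff[OF DERIV_const u, of 1] by (simp add: damped_reflect_def)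
        have "force L (\<lambda>\<beta>. fst (damped_reflect (\<phi> t) \<beta>)) \<alpha> = - force L (\<lambda>\<beta>. fst (\<phi> t \<beta>)) \<alpha>"
          by (simp add: damped_reflect_def force_reflect[of "\<lambda>\<beta>. fst (\<phi> t \<beta>)"])
        then have "(force L (\<lambda>\<beta>. fst (damped_reflect (\<phi> t) \<beta>)) \<alpha> - snd (damped_reflect (\<phi> t) \<alpha>)) / lam
            = - ((force L (\<lambda>\<beta>. fst (\<phi> t \<beta>)) \<alpha> - snd (\<phi> t \<alpha>)) / lam)"
          by (simp add: damped_reflect_def diff_divide_distrib)
        then show "((\<lambda>s. snd (damped_reflect (\<phi> s) \<alpha>)) has_real_derivative
            (force L (\<lambda>\<beta>. fst (damped_reflect (\<phi> t) \<beta>)) \<alpha> - snd (damped_reflect (\<phi> t) \<alpha>)) / lam) (at t within {0..})"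
          using DERIV_minus[OF v] by (simp only:) (simp add: damped_reflect_def)
      qed
    qed (simp_all add: damped_reflect_in_space, simp_all add: damped_reflect_def translate_def)
  qed
  ultimately show ?thesis unfolding Let_def by blast
qed

end
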